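(* Let $X$ be a complex $m\times n$ matrix such that $\|X\|_S=1$. Then $X$ belongs to the set $\dfrac{k_G^{\mathbb C}}{2-k_G^{\mathbb C}}\,\mathcal V$.
   Context: $\|X\|_S$ is the Schur multiplier norm $\sup\{\|X\circ A\|_\infty: A\in M_{(m,n)}(\mathbb C),\ \|A\|_\infty\le1\}$, where $\circ$ is the entrywise product and $\|\cdot\|_\infty$ is the operator norm of matrices. $\mathcal V\subseteq M_{(m,n)}(\mathbb C)$ is the closed convex hull of all rank one matrices $(u_iv_j)_{i,j}$ with $u\in\mathbb C^m$, $v\in\mathbb C^n$, $|u_i|=1$ for all $i$ and $|v_j|=1$ for all $j$. $k_G^{\mathbb C}$ is the little Grothendieck constant: the smallest constant $k$ such that $\|Y\|_{cbF}\le\sqrt{k}\,\|Y\|_F$ for all $m,n$ and all complex $m\times n$ matrices $Y$ (known value $4/\pi$). Here $\|Y\|_F$ is the norm of $Y$ as an operator from $(\mathbb C^n,\|\cdot\|_\infty)$ (max norm) to $(\mathbb C^m,\|\cdot\|_2)$, and $\|Y\|_{cbF}$ is the completely bounded norm of this operator (into the column Hilbert space), concretely $\|Y\|_{cbF}=\min\{\|B\|_\infty: Y=B\Delta_n(\xi),\ \xi_j\ge0,\ \|\xi\|_2=1\}$, where $\Delta_n(\xi)$ is the diagonal matrix with diagonal $\xi$. *)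

theory Defs
  imports "HOL-Analysis.Analysis"
begin

definition schur_product ::
    "complex^'n^'m \<Rightarrow> complex^'n^'m \<Rightarrow> complex^'n^'m"  (infixl "\<circ>\<^sub>S" 70)
  where "X \<circ>\<^sub>S A = (\<chi> i j. X $ i $ j * A $ i $ j)"

(* The norm on complex^'n is the Euclidean one, so onorm is the operator norm of a matrix.
   (onorm is defined over real scalars; for maps between complex spaces this is the same number.) *)
definition schur_norm :: "complex^'n^'m \<Rightarrow> real"
  where "schur_norm X =
    Sup {onorm ((*v) (X \<circ>\<^sub>S A)) | A. onorm ((*v) A) \<le> 1}"

definition unimodular_hull :: "(complex^'n^'m) set"
  where "unimodular_hull = closure (convex hull
    {(\<chi> i j. u $ i * v $ j) | u v. (\<forall>i. cmod (u $ i) = 1) \<and> (\<forall>j. cmod (v $ j) = 1)})"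

(* The little Grothendieck constant quantifies over all matrix sizes, which cannot be done with
   type-indexed dimensions. In the definitions below an m x n matrix is a function
   Y :: nat => nat => complex, read only at the indices i < m, j < n; likewise for vectors. *)

definition fun_mult_vec ::
    "nat \<Rightarrow> (nat \<Rightarrow> nat \<Rightarrow> complex) \<Rightarrow> (nat \<Rightarrow> complex) \<Rightarrow> nat \<Rightarrow> complex"
  where "fun_mult_vec n Y x i = (\<Sum>j<n. Y i j * x j)"

definition fun_norm2 :: "nat \<Rightarrow> (nat \<Rightarrow> complex) \<Rightarrow> real"
  where "fun_norm2 n x = L2_set (\<lambda>j. cmod (x j)) {..<n}"

definition fun_op_norm :: "nat \<Rightarrow> nat \<Rightarrow> (nat \<Rightarrow> nat \<Rightarrow> complex) \<Rightarrow> real"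
  where "fun_op_norm m n B = Sup {fun_norm2 m (fun_mult_vec n B x) | x. fun_norm2 n x \<le> 1}"

definition F_norm :: "nat \<Rightarrow> nat \<Rightarrow> (nat \<Rightarrow> nat \<Rightarrow> complex) \<Rightarrow> real"
  where "F_norm m n Y = Sup {fun_norm2 m (fun_mult_vec n Y x) | x. \<forall>j<n. cmod (x j) \<le> 1}"

(* The completely bounded norm of Y from l_infinity^n into the column Hilbert space C^m, in its
   concrete form: the infimum (attained, by compactness) of the operator norms of B over all
   factorizations Y = B * diag xi with xi a nonnegative unit vector. *)
definition cbF_norm :: "nat \<Rightarrow> nat \<Rightarrow> (nat \<Rightarrow> nat \<Rightarrow> complex) \<Rightarrow> real"
  where "cbF_norm m n Y = Inf {fun_op_norm m n B | B \<xi>.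
    (\<forall>j<n. 0 \<le> (\<xi> j :: real)) \<and> L2_set \<xi> {..<n} = 1 \<and>
    (\<forall>i<m. \<forall>j<n. Y i j = B i j * complex_of_real (\<xi> j))}"

(* The infimum is attained, the constraint being closed in k. Sizes are positive because for
   n = 0 no unit vector xi exists. *)
definition little_grothendieck_complex :: real
  where "little_grothendieck_complex = Inf {k. 0 \<le> k \<and>
    (\<forall>m\<ge>1. \<forall>n\<ge>1. \<forall>Y. cbF_norm m n Y \<le> sqrt k * F_norm m n Y)}"

end

theory Submission
  imports Defs "HOL-Probability.Probability"
begin

text \<open>
  Write \<open>k\<close> for the little Grothendieck constant. By the separation theorem it suffices to show, for
  every matrix \<open>A\<close> with \<open>Re (\<Sum> A\<^sub>i\<^sub>j u\<^sub>i v\<^sub>j) \<le> N\<close> for all unimodular \<open>u\<close>, \<open>v\<close>, that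
  \<open>Re (\<Sum> A\<^sub>i\<^sub>j X\<^sub>i\<^sub>j) \<le> k N / (2 - k)\<close> (\<open>schur_norm_pairing_le\<close>).

  Call a number \<open>M\<close> admissible if \<open>2 Re (\<Sum> A\<^sub>i\<^sub>j p\<^sub>i q\<^sub>j) \<le> \<Sum> l\<^sub>i |p\<^sub>i|\<^sup>2 + \<Sum> t\<^sub>j |q\<^sub>j|\<^sup>2\<close> for all \<open>p\<close>, \<open>q\<close>,
  with nonnegative weights of total mass \<open>M\<close>. Such a domination factors \<open>A\<close> through a contraction
  between two diagonal matrices, and a Schur multiplier of norm one then gives
  \<open>2 Re (\<Sum> A\<^sub>i\<^sub>j X\<^sub>i\<^sub>j) \<le> M\<close> (\<open>form_dominated_imp_pairing_le\<close>).

  The constant \<open>k\<close> improves admissible masses (\<open>form_dominated_improve\<close>). The Hermitian matrix with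
  diagonal \<open>(l, t)\<close> and off-diagonal blocks \<open>A\<close>, \<open>A*\<close> is positive semidefinite, so it has the form
  \<open>Y* Y\<close>, and its quadratic form is at most \<open>M + 2 N\<close> on the polydisc. By the definition of \<open>k\<close> it
  lies below a diagonal form of mass arbitrarily close to \<open>k (M + 2 N)\<close>. Subtracting the original
  diagonal shows that the infimum \<open>M\<close> of the admissible masses satisfies \<open>M \<le> k (M + 2 N) - M\<close>, that is
  \<open>M \<le> 2 k N / (2 - k)\<close>, provided that \<open>k < 2\<close>.

  It remains to prove that \<open>k\<close> is attained and satisfies \<open>1 \<le> k < 2\<close>. The upper bound is a
  quantitative little Grothendieck inequality, which is also obtained by self-improvement
  (\<open>dominated_improve\<close>). If \<open>Y* Y\<close> lies below a diagonal matrix, then for Gaussian combinations \<open>W\<close>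
  of vectors the difference between \<open>4 W\<close> and its coordinatewise phase is small enough on average to
  yield, through Pietsch domination (\<open>pietsch_domination\<close>), a diagonal matrix of smaller trace.
  The fixed point gives \<open>k \<le> 1.94\<close>.
\<close>

section \<open>Minimax and Pietsch domination\<close>

text \<open>A minimax principle for two functions. The set \<open>K\<close> needs no vector space structure: the functions
  are affine in the sense that convex combinations of their values at points of \<open>K\<close> are again
  attained, simultaneously. The proof separates the origin from the convex closed set of
  all pairs lying below some point \<open>(f s, g s)\<close> in the plane.\<close>

lemma two_affine_alternative:
  fixes f g :: "'b::topological_space \<Rightarrow> real"
  assumes K: "compact K" "K \<noteq> {}" and f: "continuous_on K f" and g: "continuous_on K g"
    and conc: "\<And>s t u. s \<in> K \<Longrightarrow> t \<in> K \<Longrightarrow> 0 \<le> u \<Longrightarrow> u \<le> 1 \<Longrightarrow>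
      \<exists>w\<in>K. f w = (1 - u) * f s + u * f t \<and> g w = (1 - u) * g s + u * g t"
    and pos: "\<And>\<alpha> \<beta>. 0 \<le> \<alpha> \<Longrightarrow> 0 \<le> \<beta> \<Longrightarrow> \<exists>s\<in>K. 0 \<le> \<alpha> * f s + \<beta> * g s"
  shows "\<exists>s\<in>K. 0 \<le> f s \<and> 0 \<le> g s"
proof (rule ccontr)
  assume no: "\<not> ?thesis"
  define S where "S = (\<lambda>s. (f s, g s)) ` K"
  define T where "T = {..0::real} \<times> {..0::real}"
  define U where "U = (\<Union>x\<in>S. \<Union>y\<in>T. {x + y})"
  have "compact S" unfolding S_def
    by (intro compact_continuous_image continuous_on_Pair f g K)
  moreover have "closed T" unfolding T_def by (intro closed_Times closed_atMost)
  ultimately have closed: "closed U" unfolding U_def by (rule compact_closed_sums)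
  have "convex S"
  proof (rule convexI)
    fix x y u v assume xy: "x \<in> S" "y \<in> S" and uv: "0 \<le> u" "0 \<le> v" "u + v = (1::real)"
    then obtain s t where st: "s \<in> K" "t \<in> K" "x = (f s, g s)" "y = (f t, g t)"
      by (auto simp: S_def)
    obtain w where w: "w \<in> K" "f w = (1 - v) * f s + v * f t" "g w = (1 - v) * g s + v * g t"
      using conc[OF st(1,2), of v] uv by auto
    have "u = 1 - v" using uv by simp
    then have "u *\<^sub>R x + v *\<^sub>R y = (f w, g w)" using st w by simp
    then show "u *\<^sub>R x + v *\<^sub>R y \<in> S" using w(1) by (auto simp: S_def)
  qed
  then have convex: "convex U" unfolding U_def T_def
    by (intro convex_sums convex_Times convex_real_interval)
  have zero: "0 \<notin> U"
  proof
    assume "0 \<in> U"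
    then obtain s p q where "s \<in> K" "p \<le> 0" "q \<le> 0" "f s + p = 0" "g s + q = 0"
      by (auto simp: U_def S_def T_def zero_prod_def)
    then have "0 \<le> f s \<and> 0 \<le> g s" by linarith
    then show False using no \<open>s \<in> K\<close> by auto
  qed
  obtain a b where ab: "inner a 0 < b" "\<And>x. x \<in> U \<Longrightarrow> inner a x > b"
    using separating_hyperplane_closed_point[OF convex closed zero] by blast
  obtain a1 a2 where a: "a = (a1, a2)" by (cases a)
  have gt: "a1 * (f s + p) + a2 * (g s + q) > 0" if "s \<in> K" "p \<le> 0" "q \<le> 0" for s p q
  proof -
    have "(f s, g s) \<in> S" "(p, q) \<in> T" using that by (auto simp: S_def T_def)
    then have "(f s, g s) + (p, q) \<in> U" unfolding U_def by blast
    from ab(2)[OF this] ab(1) show ?thesis by (simp add: a)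
  qed
  obtain s where s: "s \<in> K" using K by auto
  let ?t = "a1 * f s + a2 * g s"
  \<comment> \<open>\<open>U\<close> is closed downwards, so the coefficients of the separating functional cannot be positive.\<close>
  have "a1 \<le> 0"
  proof (rule ccontr)
    assume a1: "\<not> a1 \<le> 0"
    have "a1 * (f s + - \<bar>?t\<bar> / a1) + a2 * (g s + 0) = ?t - \<bar>?t\<bar>"
      using a1 by (simp add: algebra_simps)
    moreover have "- \<bar>?t\<bar> / a1 \<le> 0" using a1 by simp
    ultimately show False using gt[OF s, of "- \<bar>?t\<bar> / a1" 0] by linarith
  qed
  moreover have "a2 \<le> 0"
  proof (rule ccontr)
    assume a2: "\<not> a2 \<le> 0"
    have "a1 * (f s + 0) + a2 * (g s + - \<bar>?t\<bar> / a2) = ?t - \<bar>?t\<bar>"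
      using a2 by (simp add: algebra_simps)
    moreover have "- \<bar>?t\<bar> / a2 \<le> 0" using a2 by simp
    ultimately show False using gt[OF s, of 0 "- \<bar>?t\<bar> / a2"] by linarith
  qed
  ultimately obtain t where "t \<in> K" "0 \<le> - a1 * f t + - a2 * g t"
    using pos[of "- a1" "- a2"] by auto
  then show False using gt[of t 0 0] by simp
qed

text \<open>Induction on the family: the new function cuts \<open>K\<close> down to the compact subset where it is
  nonnegative, and the principle for two functions shows that the weighted sums of the others still
  reach nonnegative values there.\<close>

lemma finite_affine_alternative:
  fixes \<Phi> :: "'c \<Rightarrow> 'b::topological_space \<Rightarrow> real"
  assumes "finite I" and "compact K"
    and cont: "\<And>i. i \<in> I \<Longrightarrow> continuous_on UNIV (\<Phi> i)"
    and conc: "\<And>s t u. s \<in> K \<Longrightarrow> t \<in> K \<Longrightarrow> 0 \<le> u \<Longrightarrow> u \<le> 1 \<Longrightarrow>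
      \<exists>w\<in>K. \<forall>i\<in>I. \<Phi> i w = (1 - u) * \<Phi> i s + u * \<Phi> i t"
    and pos: "\<And>h. (\<And>i. i \<in> I \<Longrightarrow> 0 \<le> h i) \<Longrightarrow> \<exists>s\<in>K. 0 \<le> (\<Sum>i\<in>I. h i * \<Phi> i s)"
  shows "\<exists>s\<in>K. \<forall>i\<in>I. 0 \<le> \<Phi> i s"
  using assms
proof (induction I arbitrary: K rule: finite_induct)
  case empty
  then show ?case by fastforce
next
  case (insert i I)
  define K' where "K' = K \<inter> {s. 0 \<le> \<Phi> i s}"
  have closed: "closed {s. 0 \<le> \<Phi> i s}"
    using insert.prems(2)[of i] by (intro closed_Collect_le continuous_on_const) auto
  have "\<exists>s\<in>K'. \<forall>i\<in>I. 0 \<le> \<Phi> i s"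
  proof (rule insert.IH)
    show "compact K'" unfolding K'_def using insert.prems(1) closed by (rule compact_Int_closed)
    show "continuous_on UNIV (\<Phi> j)" if "j \<in> I" for j using insert.prems(2) that by auto
    show "\<exists>w\<in>K'. \<forall>j\<in>I. \<Phi> j w = (1 - u) * \<Phi> j s + u * \<Phi> j t"
      if "s \<in> K'" "t \<in> K'" "0 \<le> u" "u \<le> 1" for s t u
    proof -
      have st: "s \<in> K" "t \<in> K" "0 \<le> \<Phi> i s" "0 \<le> \<Phi> i t" using that by (auto simp: K'_def)
      note u = \<open>0 \<le> u\<close> \<open>u \<le> 1\<close>
      obtain w where w: "w \<in> K" "\<forall>j\<in>insert i I. \<Phi> j w = (1 - u) * \<Phi> j s + u * \<Phi> j t"
        using insert.prems(3)[OF st(1,2) u] by blast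
      then have "0 \<le> \<Phi> i w" using st u by simp
      then show ?thesis using w unfolding K'_def by blast
    qed
    show "\<exists>s\<in>K'. 0 \<le> (\<Sum>j\<in>I. h j * \<Phi> j s)" if h: "\<And>j. j \<in> I \<Longrightarrow> 0 \<le> h j" for h
    proof -
      let ?g = "\<lambda>s. \<Sum>j\<in>I. h j * \<Phi> j s"
      have "\<exists>s\<in>K. 0 \<le> ?g s \<and> 0 \<le> \<Phi> i s"
      proof (rule two_affine_alternative)
        show "compact K" by fact
        show "K \<noteq> {}" using insert.prems(4)[of "\<lambda>_. 0"] by auto
        show "continuous_on K (\<Phi> i)"
          by (rule continuous_on_subset[OF insert.prems(2)[of i]]) simp_all
        show "continuous_on K ?g"
          by (intro continuous_intros continuous_on_subset[OF insert.prems(2)]) simp_all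
        show "\<exists>w\<in>K. ?g w = (1 - u) * ?g s + u * ?g t \<and> \<Phi> i w = (1 - u) * \<Phi> i s + u * \<Phi> i t"
          if "s \<in> K" "t \<in> K" "0 \<le> u" "u \<le> 1" for s t u
        proof -
          note st = that
          obtain w where w: "w \<in> K" "\<forall>j\<in>insert i I. \<Phi> j w = (1 - u) * \<Phi> j s + u * \<Phi> j t"
            using insert.prems(3)[OF st] by blast
          have "?g w = (\<Sum>j\<in>I. (1 - u) * (h j * \<Phi> j s) + u * (h j * \<Phi> j t))"
            using w(2) by (intro sum.cong refl) (simp add: distrib_left mult.left_commute)
          also have "\<dots> = (1 - u) * ?g s + u * ?g t"
            by (simp add: sum.distrib sum_distrib_left)
          finally show ?thesis using w by blast
        qed
        show "\<exists>s\<in>K. 0 \<le> \<alpha> * ?g s + \<beta> * \<Phi> i s" if "0 \<le> \<alpha>" "0 \<le> \<beta>" for \<alpha> \<beta>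
        proof -
          let ?h = "\<lambda>j. if j = i then \<beta> else \<alpha> * h j"
          have "0 \<le> ?h j" if "j \<in> insert i I" for j
            using that h \<open>0 \<le> \<alpha>\<close> \<open>0 \<le> \<beta>\<close> by auto
          from insert.prems(4)[of ?h, OF this]
          obtain s where s: "s \<in> K" "0 \<le> (\<Sum>j\<in>insert i I. ?h j * \<Phi> j s)" by blast
          have "(\<Sum>j\<in>I. ?h j * \<Phi> j s) = (\<Sum>j\<in>I. \<alpha> * (h j * \<Phi> j s))"
            using insert.hyps by (intro sum.cong) (auto simp: algebra_simps)
          then have "(\<Sum>j\<in>insert i I. ?h j * \<Phi> j s) = \<alpha> * ?g s + \<beta> * \<Phi> i s"
            using insert.hyps by (simp add: sum_distrib_left)
          then show ?thesis using s by (intro bexI[of _ s]) simp_all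
        qed
      qed
      then show ?thesis unfolding K'_def by blast
    qed
  qed
  then show ?case unfolding K'_def by blast
qed

lemma affine_alternative:
  fixes \<Phi> :: "'c \<Rightarrow> 'b::topological_space \<Rightarrow> real"
  assumes "compact K"
    and cont: "\<And>i. continuous_on UNIV (\<Phi> i)"
    and conc: "\<And>s t u. s \<in> K \<Longrightarrow> t \<in> K \<Longrightarrow> 0 \<le> u \<Longrightarrow> u \<le> 1 \<Longrightarrow>
      \<exists>w\<in>K. \<forall>i. \<Phi> i w = (1 - u) * \<Phi> i s + u * \<Phi> i t"
    and pos: "\<And>I h. finite I \<Longrightarrow> (\<And>i. i \<in> I \<Longrightarrow> 0 \<le> h i) \<Longrightarrow>
      \<exists>s\<in>K. 0 \<le> (\<Sum>i\<in>I. h i * \<Phi> i s)"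
  shows "\<exists>s\<in>K. \<forall>i. 0 \<le> \<Phi> i s"
proof -
  have "K \<inter> (\<Inter>i\<in>UNIV. {s. 0 \<le> \<Phi> i s}) \<noteq> {}"
  proof (rule compact_imp_fip_image)
    show "closed {s. 0 \<le> \<Phi> i s}" for i
      by (intro closed_Collect_le continuous_on_const cont)
    show "K \<inter> (\<Inter>i\<in>I. {s. 0 \<le> \<Phi> i s}) \<noteq> {}" if "finite I" for I
    proof -
      have "\<exists>s\<in>K. \<forall>i\<in>I. 0 \<le> \<Phi> i s"
      proof (rule finite_affine_alternative)
        show "\<exists>w\<in>K. \<forall>i\<in>I. \<Phi> i w = (1 - u) * \<Phi> i s + u * \<Phi> i t"
          if "s \<in> K" "t \<in> K" "0 \<le> u" "u \<le> 1" for s t u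
          using conc[OF that] by blast
      qed (use that assms in auto)
      then show ?thesis by auto
    qed
  qed fact
  then show ?thesis by auto
qed

lemma compact_simplex:
  fixes J :: "'a set"
  assumes "finite J"
  shows "compact {l::'a \<Rightarrow> real. (\<forall>j. 0 \<le> l j) \<and> (\<forall>j. j \<notin> J \<longrightarrow> l j = 0) \<and> sum l J = 1}"
    (is "compact ?K")
proof -
  have "compactin (product_topology (\<lambda>_. euclidean) UNIV) (PiE UNIV (\<lambda>_::'a. {0..1::real}))"
    unfolding compactin_PiE by (simp add: compactin_euclidean_iff)
  then have "compact (PiE UNIV (\<lambda>_::'a. {0..1::real}))"
    by (simp add: euclidean_product_topology compactin_euclidean_iff)
  moreover have "closed {l::'a \<Rightarrow> real. (\<forall>j. j \<notin> J \<longrightarrow> l j = 0) \<and> sum l J = 1}"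
    by (intro closed_Collect_conj closed_Collect_all closed_Collect_imp closed_Collect_eq
        open_Collect_const continuous_intros continuous_on_product_coordinates)
  moreover have "?K = PiE UNIV (\<lambda>_. {0..1}) \<inter> {l. (\<forall>j. j \<notin> J \<longrightarrow> l j = 0) \<and> sum l J = 1}"
  proof -
    have "l j \<le> 1" if "\<forall>j. 0 \<le> l j" "\<forall>j. j \<notin> J \<longrightarrow> l j = 0" "sum l J = 1" for l :: "'a \<Rightarrow> real" and j
      using that member_le_sum[of j J l] assms by (cases "j \<in> J") auto
    then show ?thesis by (auto simp: PiE_def Pi_def)
  qed
  ultimately show ?thesis by (simp only: compact_Int_closed)
qed

text \<open>Pietsch domination: a function \<open>q\<close> of vectors lies below a diagonal quadratic form of trace \<open>M\<close>
  as soon as each finite weighted sum of values of \<open>q\<close> is at most \<open>M\<close> times the largest coordinate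
  of the corresponding sum of squares. The weights of the diagonal form are found in the simplex
  by \<open>affine_alternative\<close>, applied to the family of all vectors.\<close>

lemma pietsch_domination:
  fixes J :: "'a set" and q :: "('a \<Rightarrow> complex) \<Rightarrow> real"
  assumes J: "finite J" "J \<noteq> {}" and M: "0 \<le> M"
    and le: "\<And>I h s. finite I \<Longrightarrow> (\<And>a. a \<in> I \<Longrightarrow> 0 \<le> h a) \<Longrightarrow>
      (\<And>j. j \<in> J \<Longrightarrow> (\<Sum>a\<in>I. h a * (cmod (a j))\<^sup>2) \<le> s) \<Longrightarrow> (\<Sum>a\<in>I. h a * q a) \<le> M * s"
  shows "\<exists>\<mu>. (\<forall>j. 0 \<le> \<mu> j) \<and> sum \<mu> J = M \<and> (\<forall>a. q a \<le> (\<Sum>j\<in>J. \<mu> j * (cmod (a j))\<^sup>2))"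
proof -
  let ?K = "{l::'a \<Rightarrow> real. (\<forall>j. 0 \<le> l j) \<and> (\<forall>j. j \<notin> J \<longrightarrow> l j = 0) \<and> sum l J = 1}"
  let ?\<Phi> = "\<lambda>a l. M * (\<Sum>j\<in>J. l j * (cmod (a j))\<^sup>2) - q a"
  have "\<exists>l\<in>?K. \<forall>a. 0 \<le> ?\<Phi> a l"
  proof (rule affine_alternative)
    show "compact ?K" using J(1) by (rule compact_simplex)
    show "continuous_on UNIV (?\<Phi> a)" for a
      by (intro continuous_intros continuous_on_product_coordinates)
    show "\<exists>w\<in>?K. \<forall>a. ?\<Phi> a w = (1 - u) * ?\<Phi> a s + u * ?\<Phi> a t"
      if "s \<in> ?K" "t \<in> ?K" "0 \<le> u" "u \<le> 1" for s t u
    proof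
      let ?w = "\<lambda>j. (1 - u) * s j + u * t j"
      show "?w \<in> ?K" using that
        by (auto simp: sum.distrib sum_distrib_left[symmetric])
      show "\<forall>a. ?\<Phi> a ?w = (1 - u) * ?\<Phi> a s + u * ?\<Phi> a t"
        by (auto simp: algebra_simps sum.distrib sum_distrib_left sum_subtractf)
    qed
    show "\<exists>l\<in>?K. 0 \<le> (\<Sum>a\<in>I. h a * ?\<Phi> a l)"
      if I: "finite I" and h: "\<And>a. a \<in> I \<Longrightarrow> 0 \<le> h a" for I h
    proof -
      \<comment> \<open>For a fixed weighted sum, all mass may be placed on the largest coordinate.\<close>
      let ?T = "\<lambda>j. \<Sum>a\<in>I. h a * (cmod (a j))\<^sup>2"
      have "Max (?T ` J) \<in> ?T ` J" using J by (intro Max_in) auto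
      then obtain k where k: "k \<in> J" "Max (?T ` J) = ?T k" by auto
      have "?T j \<le> ?T k" if "j \<in> J" for j
        using Max_ge[of "?T ` J" "?T j"] J that k by auto
      then have "(\<Sum>a\<in>I. h a * q a) \<le> M * ?T k" by (intro le I h) auto
      moreover have "(\<lambda>j. if j = k then 1 else 0) \<in> ?K" using J k by auto
      moreover have "(\<Sum>j\<in>J. (if j = k then 1 else 0) * (cmod (a j))\<^sup>2) = (cmod (a k))\<^sup>2" for a
        using J k by (simp add: if_distrib[of "\<lambda>x. x * _"] cong: if_cong)
      ultimately show ?thesis
        by (intro bexI[of _ "\<lambda>j. if j = k then 1 else 0"])
          (auto simp: algebra_simps sum_subtractf sum_distrib_left)
    qed
  qed
  then obtain l where l: "\<And>j. 0 \<le> l j" "sum l J = 1" and dom: "\<And>a. 0 \<le> ?\<Phi> a l" by auto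
  show ?thesis
  proof (intro exI[of _ "\<lambda>j. M * l j"] conjI allI)
    show "0 \<le> M * l j" for j using l M by simp
    show "(\<Sum>j\<in>J. M * l j) = M" using l(2) by (simp add: sum_distrib_left[symmetric])
    show "q a \<le> (\<Sum>j\<in>J. M * l j * (cmod (a j))\<^sup>2)" for a
      using dom[of a] by (simp add: sum_distrib_left mult.assoc)
  qed
qed

section \<open>Linear combinations of independent Gaussian variables\<close>

text \<open>The cubic Taylor bound gives \<open>sin 0.54 > 1/2 = sin (\<pi>/6)\<close>.\<close>

lemma pi_less_324: "pi < 3.24"
proof (rule ccontr)
  assume "\<not> pi < 3.24"
  then have le: "0.54 \<le> pi / 6" by simp
  have "sin 0.54 \<le> sin (pi / 6)"
    using le pi_gt_zero by (intro sin_monotone_2pi_le) auto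
  moreover have "\<bar>sin 0.54 - (\<Sum>m<3. sin_coeff m * 0.54 ^ m)\<bar> \<le> inverse (fact 3) * \<bar>0.54::real\<bar> ^ 3"
    by (rule Maclaurin_sin_bound)
  ultimately show False
    by (simp add: sin_30 sin_coeff_def eval_nat_numeral lessThan_Suc field_simps)
qed

lemma sqrt_two_over_pi_bounds: "0.78 \<le> sqrt (2 / pi)" "sqrt (2 / pi) \<le> 1"
proof -
  have "(0.78::real)\<^sup>2 \<le> 2 / pi"
    using pi_less_324 pi_gt_zero by (simp add: field_simps power2_eq_square)
  then show "0.78 \<le> sqrt (2 / pi)" by (rule real_le_rsqrt)
  show "sqrt (2 / pi) \<le> 1" using pi_ge_two by simp
qed

text \<open>The law of a family of independent standard real Gaussian variables indexed by \<open>I\<close>.\<close>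

definition gauss_space :: "'a set \<Rightarrow> ('a \<Rightarrow> real) measure"
  where "gauss_space I = PiM I (\<lambda>_. density lborel (\<lambda>x. ennreal (std_normal_density x)))"

lemma prob_space_gauss_space: "prob_space (gauss_space I)"
  unfolding gauss_space_def by (intro prob_space_PiM prob_space_normal_density) simp

lemma gauss_space_linear_distributed:
  fixes b :: "'a \<Rightarrow> real"
  assumes I: "finite I" "I \<noteq> {}" and b: "\<And>i. i \<in> I \<Longrightarrow> b i \<noteq> 0" and J: "I \<subseteq> J"
  shows "distributed (gauss_space J) lborel (\<lambda>\<omega>. \<Sum>i\<in>I. b i * \<omega> i)
           (normal_density 0 (sqrt (\<Sum>i\<in>I. (b i)\<^sup>2)))"
proof -
  interpret prob_space "gauss_space J" by (rule prob_space_gauss_space)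
  let ?D = "density lborel (\<lambda>x. ennreal (std_normal_density x))"
  have rv: "random_variable borel (\<lambda>\<omega>. \<omega> i)" if "i \<in> J" for i
  proof -
    have "(\<lambda>\<omega>. \<omega> i) \<in> measurable (gauss_space J) ?D"
      unfolding gauss_space_def using that by (rule measurable_component_singleton)
    then show ?thesis by simp
  qed
  have comp: "distr (gauss_space J) ?D (\<lambda>\<omega>. \<omega> i) = ?D" if "i \<in> J" for i
    unfolding gauss_space_def using that
    by (intro distr_PiM_component prob_space_normal_density) simp_all
  have dist: "distributed (gauss_space J) lborel (\<lambda>\<omega>. \<omega> i) std_normal_density" if "i \<in> J" for i
  proof -
    have "distr (gauss_space J) lborel (\<lambda>\<omega>. \<omega> i) = distr (gauss_space J) ?D (\<lambda>\<omega>. \<omega> i)"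
      by (intro distr_cong) simp_all
    then show ?thesis unfolding distributed_def using comp[OF that] rv[OF that] by simp
  qed
  have "indep_vars (\<lambda>_. ?D) (\<lambda>i \<omega>. \<omega> i) J"
  proof (subst indep_vars_iff_distr_eq_PiM')
    show "J \<noteq> {}" using I J by auto
    show "random_variable ?D (\<lambda>\<omega>. \<omega> i)" if "i \<in> J" for i
      using rv[OF that] by simp
    have "distr (gauss_space J) (PiM J (\<lambda>_. ?D)) (\<lambda>\<omega>. \<lambda>i\<in>J. \<omega> i)
        = distr (gauss_space J) (gauss_space J) (\<lambda>\<omega>. \<omega>)"
      by (intro distr_cong) (auto simp: gauss_space_def space_PiM PiE_def extensional_restrict)
    also have "\<dots> = (\<Pi>\<^sub>M i\<in>J. distr (gauss_space J) ?D (\<lambda>\<omega>. \<omega> i))"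
      using comp by (simp add: distr_id2 gauss_space_def cong: PiM_cong)
    finally show "distr (gauss_space J) (PiM J (\<lambda>_. ?D)) (\<lambda>\<omega>. \<lambda>i\<in>J. \<omega> i)
        = (\<Pi>\<^sub>M i\<in>J. distr (gauss_space J) ?D (\<lambda>\<omega>. \<omega> i))" .
  qed
  then have "indep_vars (\<lambda>_. borel) (\<lambda>i \<omega>. b i * \<omega> i) J"
    by (rule indep_vars_compose2[where Y = "\<lambda>i x. b i * x"]) simp
  then have ind: "indep_vars (\<lambda>_. borel) (\<lambda>i \<omega>. b i * \<omega> i) I"
    using J by (rule indep_vars_subset)
  have "distributed (gauss_space J) lborel (\<lambda>\<omega>. b i * \<omega> i) (normal_density 0 \<bar>b i\<bar>)" if "i \<in> I" for i
    using normal_density_affine[OF dist, of i "b i" 0] b[OF that] that J by auto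
  from sum_indep_normal[OF I ind _ this] b show ?thesis by simp
qed

lemma gauss_space_linear_moments:
  fixes b :: "'a \<Rightarrow> real"
  assumes "finite J"
  defines "S \<equiv> (\<lambda>\<omega>. \<Sum>i\<in>J. b i * \<omega> i)"
  shows "integrable (gauss_space J) (\<lambda>\<omega>. (S \<omega>)\<^sup>2)"
    and "(\<integral>\<omega>. (S \<omega>)\<^sup>2 \<partial>gauss_space J) = (\<Sum>i\<in>J. (b i)\<^sup>2)"
    and "integrable (gauss_space J) (\<lambda>\<omega>. \<bar>S \<omega>\<bar>)"
    and "(\<integral>\<omega>. \<bar>S \<omega>\<bar> \<partial>gauss_space J) = sqrt (2 / pi) * sqrt (\<Sum>i\<in>J. (b i)\<^sup>2)"
proof -
  \<comment> \<open>Variables with coefficient zero are dropped, since the normal density needs a positive variance.\<close>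
  define I where "I = {i\<in>J. b i \<noteq> 0}"
  have S: "S = (\<lambda>\<omega>. \<Sum>i\<in>I. b i * \<omega> i)"
    unfolding S_def I_def using assms(1) by (intro ext sum.mono_neutral_right) auto
  have b2: "(\<Sum>i\<in>J. (b i)\<^sup>2) = (\<Sum>i\<in>I. (b i)\<^sup>2)"
    unfolding I_def using assms(1) by (intro sum.mono_neutral_right) auto
  have *: "integrable (gauss_space J) (\<lambda>\<omega>. (S \<omega>)\<^sup>2) \<and>
    (\<integral>\<omega>. (S \<omega>)\<^sup>2 \<partial>gauss_space J) = (\<Sum>i\<in>J. (b i)\<^sup>2) \<and>
    integrable (gauss_space J) (\<lambda>\<omega>. \<bar>S \<omega>\<bar>) \<and>
    (\<integral>\<omega>. \<bar>S \<omega>\<bar> \<partial>gauss_space J) = sqrt (2 / pi) * sqrt (\<Sum>i\<in>J. (b i)\<^sup>2)"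
  proof (cases "I = {}")
    case True
    then show ?thesis unfolding S b2 by simp
  next
    case False
    define \<sigma> where "\<sigma> = sqrt (\<Sum>i\<in>I. (b i)\<^sup>2)"
    have fin: "finite I" using assms(1) by (simp add: I_def)
    have "0 < (\<Sum>i\<in>I. (b i)\<^sup>2)" using False fin by (intro sum_pos) (auto simp: I_def)
    then have \<sigma>: "0 < \<sigma>" "(\<Sum>i\<in>I. (b i)\<^sup>2) = \<sigma>\<^sup>2" by (auto simp: \<sigma>_def)
    have D: "distributed (gauss_space J) lborel S (normal_density 0 \<sigma>)"
      unfolding S \<sigma>_def by (rule gauss_space_linear_distributed) (use False fin in \<open>auto simp: I_def\<close>)
    have 2: "has_bochner_integral lborel (\<lambda>x. normal_density 0 \<sigma> x * x\<^sup>2) (\<sigma>\<^sup>2)"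
      using normal_moment_even[OF \<sigma>(1), of 0 1] \<sigma>(1) by simp
    have 1: "has_bochner_integral lborel (\<lambda>x. normal_density 0 \<sigma> x * \<bar>x\<bar>) (\<sigma> * sqrt (2 / pi))"
      using normal_moment_abs_odd[OF \<sigma>(1), of 0 0] by simp
    show ?thesis unfolding b2 \<sigma>(2)
      using distributed_integral[OF D, of "\<lambda>x. x\<^sup>2"] distributed_integrable[OF D, of "\<lambda>x. x\<^sup>2"]
        distributed_integral[OF D, of abs] distributed_integrable[OF D, of abs] 1 2 \<sigma>(1)
      by (auto simp: has_bochner_integral_iff mult.commute)
  qed
  then show "integrable (gauss_space J) (\<lambda>\<omega>. (S \<omega>)\<^sup>2)"
    "(\<integral>\<omega>. (S \<omega>)\<^sup>2 \<partial>gauss_space J) = (\<Sum>i\<in>J. (b i)\<^sup>2)"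
    "integrable (gauss_space J) (\<lambda>\<omega>. \<bar>S \<omega>\<bar>)"
    "(\<integral>\<omega>. \<bar>S \<omega>\<bar> \<partial>gauss_space J) = sqrt (2 / pi) * sqrt (\<Sum>i\<in>J. (b i)\<^sup>2)"
    by blast+
qed

lemma gauss_space_complex_sq:
  fixes d :: "'a \<Rightarrow> complex"
  assumes I: "finite I" and h: "\<And>a. a \<in> I \<Longrightarrow> 0 \<le> h a"
  shows "has_bochner_integral (gauss_space I)
           (\<lambda>\<omega>. (cmod (\<Sum>a\<in>I. complex_of_real (sqrt (h a) * \<omega> a) * d a))\<^sup>2)
           (\<Sum>a\<in>I. h a * (cmod (d a))\<^sup>2)"
proof -
  let ?b = "\<lambda>a. sqrt (h a) * Re (d a)" and ?c = "\<lambda>a. sqrt (h a) * Im (d a)"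
  have eq: "(cmod (\<Sum>a\<in>I. complex_of_real (sqrt (h a) * \<omega> a) * d a))\<^sup>2 =
      (\<Sum>a\<in>I. ?b a * \<omega> a)\<^sup>2 + (\<Sum>a\<in>I. ?c a * \<omega> a)\<^sup>2" for \<omega>
    by (simp add: cmod_power2 mult_ac)
  have "(\<Sum>a\<in>I. h a * (cmod (d a))\<^sup>2) = (\<Sum>a\<in>I. (?b a)\<^sup>2) + (\<Sum>a\<in>I. (?c a)\<^sup>2)"
    using h by (simp add: sum.distrib[symmetric] cmod_power2 power_mult_distrib distrib_left)
  then show ?thesis unfolding eq
    using gauss_space_linear_moments(1,2)[OF I, of ?b] gauss_space_linear_moments(1,2)[OF I, of ?c]
    by (auto simp: has_bochner_integral_iff)
qed

text \<open>With \<open>T = \<Sum> h |d|\<^sup>2\<close>, the modulus of the complex combination \<open>W\<close> has expectation at least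
  \<open>sqrt (2/\<pi>) sqrt T\<close>. If \<open>\<sigma>\<close> and \<open>\<tau>\<close> are the standard deviations of its real part \<open>U\<close> and
  imaginary part \<open>V\<close>, then \<open>g = (\<sigma> |U| + \<tau> |V|) / sqrt T\<close> lies below \<open>|W|\<close> by the Cauchy-Schwarz
  inequality and has exactly this expectation.\<close>

lemma gauss_space_complex_abs:
  fixes d :: "'a \<Rightarrow> complex"
  assumes I: "finite I" and h: "\<And>a. a \<in> I \<Longrightarrow> 0 \<le> h a"
  shows "\<exists>g. has_bochner_integral (gauss_space I) g
            (sqrt (2 / pi) * sqrt (\<Sum>a\<in>I. h a * (cmod (d a))\<^sup>2)) \<and>
          (\<forall>\<omega>. g \<omega> \<le> cmod (\<Sum>a\<in>I. complex_of_real (sqrt (h a) * \<omega> a) * d a))"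
proof -
  let ?b = "\<lambda>a. sqrt (h a) * Re (d a)" and ?c = "\<lambda>a. sqrt (h a) * Im (d a)"
  define \<sigma> where "\<sigma> = sqrt (\<Sum>a\<in>I. (?b a)\<^sup>2)"
  define \<tau> where "\<tau> = sqrt (\<Sum>a\<in>I. (?c a)\<^sup>2)"
  define T where "T = (\<Sum>a\<in>I. h a * (cmod (d a))\<^sup>2)"
  define U where "U = (\<lambda>\<omega>. \<Sum>a\<in>I. ?b a * \<omega> a)"
  define V where "V = (\<lambda>\<omega>. \<Sum>a\<in>I. ?c a * \<omega> a)"
  have T: "T = \<sigma>\<^sup>2 + \<tau>\<^sup>2" unfolding T_def \<sigma>_def \<tau>_def
    using h by (simp add: sum_nonneg sum.distrib[symmetric] cmod_power2 power_mult_distrib distrib_left)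
  let ?g = "\<lambda>\<omega>. (\<sigma> * \<bar>U \<omega>\<bar> + \<tau> * \<bar>V \<omega>\<bar>) / sqrt T"
  have "has_bochner_integral (gauss_space I) ?g
      ((\<sigma> * (sqrt (2 / pi) * \<sigma>) + \<tau> * (sqrt (2 / pi) * \<tau>)) / sqrt T)"
    unfolding U_def V_def \<sigma>_def \<tau>_def
    using gauss_space_linear_moments(3,4)[OF I, of ?b] gauss_space_linear_moments(3,4)[OF I, of ?c]
    by (intro has_bochner_integral_divide_zero has_bochner_integral_add has_bochner_integral_mult_right)
      (auto simp: has_bochner_integral_iff)
  moreover have "(\<sigma> * (sqrt (2 / pi) * \<sigma>) + \<tau> * (sqrt (2 / pi) * \<tau>)) / sqrt T = sqrt (2 / pi) * sqrt T"
  proof -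
    have "\<sigma> * (sqrt (2 / pi) * \<sigma>) + \<tau> * (sqrt (2 / pi) * \<tau>) = sqrt (2 / pi) * T"
      unfolding T by (simp add: power2_eq_square distrib_left)
    moreover have "0 \<le> T" unfolding T by simp
    ultimately show ?thesis by (metis real_div_sqrt times_divide_eq_right)
  qed
  moreover have "?g \<omega> \<le> cmod (\<Sum>a\<in>I. complex_of_real (sqrt (h a) * \<omega> a) * d a)" for \<omega>
  proof -
    let ?W = "\<Sum>a\<in>I. complex_of_real (sqrt (h a) * \<omega> a) * d a"
    have W: "cmod ?W = sqrt ((U \<omega>)\<^sup>2 + (V \<omega>)\<^sup>2)"
      by (simp add: cmod_def U_def V_def mult_ac)
    have "(\<sigma> * \<bar>U \<omega>\<bar> + \<tau> * \<bar>V \<omega>\<bar>)\<^sup>2 \<le> (\<sigma>\<^sup>2 + \<tau>\<^sup>2) * ((U \<omega>)\<^sup>2 + (V \<omega>)\<^sup>2)"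
      using zero_le_power2[of "\<sigma> * \<bar>V \<omega>\<bar> - \<tau> * \<bar>U \<omega>\<bar>"]
      by (simp add: power2_eq_square algebra_simps)
    then have "\<sigma> * \<bar>U \<omega>\<bar> + \<tau> * \<bar>V \<omega>\<bar> \<le> sqrt T * cmod ?W"
      unfolding W T by (metis real_le_rsqrt real_sqrt_mult)
    then show ?thesis unfolding T
      by (cases "\<sigma>\<^sup>2 + \<tau>\<^sup>2 = 0") (auto simp: divide_le_eq mult.commute add_nonneg_eq_0_iff sum_power2_gt_zero_iff)
  qed
  ultimately show ?thesis unfolding T_def by auto
qed

section \<open>Norms of matrices and diagonal domination\<close>

lemma fun_norm2_sq: "(fun_norm2 n x)\<^sup>2 = (\<Sum>j<n. (cmod (x j))\<^sup>2)"
  by (simp add: fun_norm2_def L2_set_def sum_nonneg)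

lemma fun_norm2_nonneg: "0 \<le> fun_norm2 n x"
  by (simp add: fun_norm2_def)

lemma fun_norm2_coord_le: "j < n \<Longrightarrow> cmod (x j) \<le> fun_norm2 n x"
  unfolding fun_norm2_def by (rule member_le_L2_set) auto

lemma fun_norm2_mult_vec_le:
  assumes "\<And>j. j < n \<Longrightarrow> cmod (x j) \<le> 1"
  shows "fun_norm2 m (fun_mult_vec n Y x) \<le> (\<Sum>i<m. \<Sum>j<n. cmod (Y i j))"
proof -
  have "fun_norm2 m (fun_mult_vec n Y x) \<le> (\<Sum>i<m. cmod (fun_mult_vec n Y x i))"
    unfolding fun_norm2_def by (rule L2_set_le_sum) simp
  also have "\<dots> \<le> (\<Sum>i<m. \<Sum>j<n. cmod (Y i j))"
  proof (rule sum_mono)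
    fix i
    have "cmod (fun_mult_vec n Y x i) \<le> (\<Sum>j<n. cmod (Y i j * x j))"
      unfolding fun_mult_vec_def by (rule norm_sum)
    also have "\<dots> \<le> (\<Sum>j<n. cmod (Y i j))"
      using assms by (intro sum_mono) (auto simp: norm_mult intro!: mult_left_le)
    finally show "cmod (fun_mult_vec n Y x i) \<le> (\<Sum>j<n. cmod (Y i j))" .
  qed
  finally show ?thesis .
qed

lemma fun_mult_vec_scale: "fun_mult_vec n Y (\<lambda>j. c * x j) = (\<lambda>i. c * fun_mult_vec n Y x i)"
  by (rule ext) (simp add: fun_mult_vec_def sum_distrib_left mult.left_commute)

lemma fun_norm2_scale: "fun_norm2 n (\<lambda>j. c * x j) = cmod c * fun_norm2 n x"
  by (simp add: fun_norm2_def norm_mult L2_set_right_distrib)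

lemma fun_norm2_le_F_norm:
  assumes "\<And>j. j < n \<Longrightarrow> cmod (x j) \<le> 1"
  shows "fun_norm2 m (fun_mult_vec n Y x) \<le> F_norm m n Y"
  unfolding F_norm_def
proof (rule cSup_upper)
  show "bdd_above {fun_norm2 m (fun_mult_vec n Y x) |x. \<forall>j<n. cmod (x j) \<le> 1}"
    by (rule bdd_aboveI[of _ "\<Sum>i<m. \<Sum>j<n. cmod (Y i j)"]) (auto intro: fun_norm2_mult_vec_le)
qed (use assms in blast)

lemma F_norm_nonneg: "0 \<le> F_norm m n Y"
  by (rule order_trans[OF fun_norm2_nonneg fun_norm2_le_F_norm[of n "\<lambda>_. 0"]]) simp

lemma F_norm_leI:
  assumes "0 \<le> c" and "\<And>x. (\<And>j. j < n \<Longrightarrow> cmod (x j) \<le> 1) \<Longrightarrow> fun_norm2 m (fun_mult_vec n Y x) \<le> c"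
  shows "F_norm m n Y \<le> c"
  unfolding F_norm_def
proof (rule cSup_least)
  have "fun_norm2 m (fun_mult_vec n Y (\<lambda>_. 0)) \<in> {fun_norm2 m (fun_mult_vec n Y x) |x. \<forall>j<n. cmod (x j) \<le> 1}"
    by (intro CollectI exI[of _ "\<lambda>_. 0"]) simp
  then show "{fun_norm2 m (fun_mult_vec n Y x) |x. \<forall>j<n. cmod (x j) \<le> 1} \<noteq> {}" by (metis empty_iff)
qed (use assms in auto)

lemma bdd_above_fun_op_norm: "bdd_above {fun_norm2 m (fun_mult_vec n B x) |x. fun_norm2 n x \<le> 1}"
proof -
  have "cmod (x j) \<le> 1" if "fun_norm2 n x \<le> 1" "j < n" for x j
    using fun_norm2_coord_le[OF that(2), of x] that(1) by linarith
  then show ?thesis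
    by (intro bdd_aboveI[of _ "\<Sum>i<m. \<Sum>j<n. cmod (B i j)"]) (auto intro!: fun_norm2_mult_vec_le)
qed

lemma fun_norm2_le_op_norm:
  "fun_norm2 m (fun_mult_vec n B x) \<le> fun_op_norm m n B * fun_norm2 n x"
proof -
  have bound: "fun_norm2 m (fun_mult_vec n B y) \<le> fun_op_norm m n B" if "fun_norm2 n y \<le> 1" for y
    unfolding fun_op_norm_def
    by (rule cSup_upper[OF _ bdd_above_fun_op_norm]) (use that in blast)
  show ?thesis
  proof (cases "fun_norm2 n x = 0")
    case True
    then have "x j = 0" if "j < n" for j using fun_norm2_coord_le[OF that, of x] by simp
    then have "fun_mult_vec n B x = (\<lambda>_. 0)" by (auto simp: fun_mult_vec_def)
    then show ?thesis using True by (simp add: fun_norm2_def L2_set_def)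
  next
    case False
    define r where "r = fun_norm2 n x"
    have r: "r > 0" using False fun_norm2_nonneg[of n x] by (simp add: r_def)
    let ?y = "\<lambda>j. complex_of_real (1 / r) * x j"
    have "fun_norm2 n ?y \<le> 1" using r unfolding fun_norm2_scale by (simp add: r_def norm_divide)
    from bound[OF this] show ?thesis
      using r unfolding fun_mult_vec_scale fun_norm2_scale
      by (simp add: r_def[symmetric] norm_divide field_simps)
  qed
qed

lemma fun_op_norm_nonneg: "0 \<le> fun_op_norm m n B"
proof -
  have "fun_norm2 m (fun_mult_vec n B (\<lambda>_. 0)) \<in> {fun_norm2 m (fun_mult_vec n B x) |x. fun_norm2 n x \<le> 1}"
    by (rule CollectI, rule exI[of _ "\<lambda>_. 0"]) (simp add: fun_norm2_def L2_set_def)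
  then have "fun_norm2 m (fun_mult_vec n B (\<lambda>_. 0)) \<le> fun_op_norm m n B"
    unfolding fun_op_norm_def by (rule cSup_upper[OF _ bdd_above_fun_op_norm])
  then show ?thesis using fun_norm2_nonneg order_trans by blast
qed

lemma fun_op_norm_leI:
  assumes "0 \<le> c" and "\<And>x. fun_norm2 n x \<le> 1 \<Longrightarrow> fun_norm2 m (fun_mult_vec n B x) \<le> c"
  shows "fun_op_norm m n B \<le> c"
  unfolding fun_op_norm_def
proof (rule cSup_least)
  have "fun_norm2 n (\<lambda>_. 0) \<le> 1" by (simp add: fun_norm2_def L2_set_def)
  then show "{fun_norm2 m (fun_mult_vec n B x) |x. fun_norm2 n x \<le> 1} \<noteq> {}" by blast
qed (use assms in auto)

text \<open>The matrix inequality \<open>Y* Y \<le> diag \<mu>\<close> for some nonnegative diagonal of trace \<open>Q\<close>, written as an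
  inequality of quadratic forms. Up to strict versus weak inequalities it says that the
  completely bounded norm of \<open>Y\<close> is at most the square root of \<open>Q\<close>; the link is \<open>Q \<xi>\<^sub>j\<^sup>2 = \<mu>\<^sub>j\<close>.\<close>

definition dominated :: "nat \<Rightarrow> nat \<Rightarrow> (nat \<Rightarrow> nat \<Rightarrow> complex) \<Rightarrow> real \<Rightarrow> bool"
  where "dominated m n Y Q \<longleftrightarrow> (\<exists>\<mu>. (\<forall>j. 0 \<le> \<mu> j) \<and> sum \<mu> {..<n} = Q \<and>
    (\<forall>a. (fun_norm2 m (fun_mult_vec n Y a))\<^sup>2 \<le> (\<Sum>j<n. \<mu> j * (cmod (a j))\<^sup>2)))"

lemma dominated_imp_cbF_norm_le:
  assumes "dominated m n Y Q" and Q: "0 < Q"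
  shows "cbF_norm m n Y \<le> sqrt Q"
proof -
  obtain \<mu> where \<mu>: "\<And>j. 0 \<le> \<mu> j" "sum \<mu> {..<n} = Q"
    and dom: "\<And>a. (fun_norm2 m (fun_mult_vec n Y a))\<^sup>2 \<le> (\<Sum>j<n. \<mu> j * (cmod (a j))\<^sup>2)"
    using assms(1) by (auto simp: dominated_def)
  define \<xi> where "\<xi> = (\<lambda>j. sqrt (\<mu> j / Q))"
  \<comment> \<open>Where \<open>\<xi> j = 0\<close> the column of \<open>B\<close> is zero by division by zero, and so is the column of \<open>Y\<close>.\<close>
  define B where "B = (\<lambda>i j. Y i j / complex_of_real (\<xi> j))"
  have \<xi>2: "(\<xi> j)\<^sup>2 = \<mu> j / Q" for j using \<mu>(1) Q by (simp add: \<xi>_def)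
  have "(L2_set \<xi> {..<n})\<^sup>2 = (\<Sum>j<n. (\<xi> j)\<^sup>2)" by (simp add: L2_set_def sum_nonneg)
  also have "\<dots> = 1" using \<mu>(2) Q by (simp add: \<xi>2 sum_divide_distrib[symmetric])
  finally have norm: "L2_set \<xi> {..<n} = 1"
    by (simp add: power2_eq_1_iff) (use L2_set_nonneg[of \<xi> "{..<n}"] in auto)
  have fact: "Y i j = B i j * complex_of_real (\<xi> j)" if "i < m" "j < n" for i j
  proof (cases "\<xi> j = 0")
    case True
    then have "\<mu> j = 0" using \<xi>2[of j] Q by simp
    let ?e = "\<lambda>k. if k = j then 1 else 0 :: complex"
    have "fun_mult_vec n Y ?e = (\<lambda>i. Y i j)"
      using that by (intro ext) (simp add: fun_mult_vec_def if_distrib[of "\<lambda>x. _ * x"] cong: if_cong)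
    moreover have "(\<Sum>k<n. \<mu> k * (cmod (?e k))\<^sup>2) = 0"
      using \<open>\<mu> j = 0\<close> by (intro sum.neutral) auto
    ultimately have "(fun_norm2 m (\<lambda>i. Y i j))\<^sup>2 \<le> 0" using dom[of ?e] by simp
    then have "fun_norm2 m (\<lambda>i. Y i j) = 0" by simp
    then show ?thesis using True fun_norm2_coord_le[OF that(1), of "\<lambda>i. Y i j"] by simp
  qed (simp add: B_def)
  have "fun_op_norm m n B \<le> sqrt Q"
  proof (rule fun_op_norm_leI)
    fix x assume x: "fun_norm2 n x \<le> 1"
    let ?a = "\<lambda>j. x j / complex_of_real (\<xi> j)"
    have "fun_mult_vec n B x = fun_mult_vec n Y ?a"
      unfolding B_def by (intro ext) (simp add: fun_mult_vec_def)
    then have "(fun_norm2 m (fun_mult_vec n B x))\<^sup>2 \<le> (\<Sum>j<n. \<mu> j * (cmod (?a j))\<^sup>2)"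
      using dom[of ?a] by simp
    also have "\<dots> \<le> (\<Sum>j<n. Q * (cmod (x j))\<^sup>2)"
    proof (rule sum_mono)
      fix j
      have "\<mu> j = Q * (\<xi> j)\<^sup>2" using \<xi>2[of j] Q by simp
      then show "\<mu> j * (cmod (?a j))\<^sup>2 \<le> Q * (cmod (x j))\<^sup>2"
        using Q by (cases "\<xi> j = 0") (auto simp: norm_divide power_divide)
    qed
    also have "\<dots> = Q * (fun_norm2 n x)\<^sup>2" by (simp add: fun_norm2_sq sum_distrib_left)
    also have "\<dots> \<le> Q * 1"
      using x Q fun_norm2_nonneg[of n x] by (intro mult_left_mono) (auto simp: power_le_one)
    finally show "fun_norm2 m (fun_mult_vec n B x) \<le> sqrt Q" by (simp add: real_le_rsqrt)
  qed (use Q in simp)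
  moreover have "cbF_norm m n Y \<le> fun_op_norm m n B"
    unfolding cbF_norm_def
  proof (rule cInf_lower)
    show "bdd_below {fun_op_norm m n B |B \<xi>. (\<forall>j<n. 0 \<le> (\<xi> j :: real)) \<and> L2_set \<xi> {..<n} = 1 \<and>
        (\<forall>i<m. \<forall>j<n. Y i j = B i j * complex_of_real (\<xi> j))}"
      by (rule bdd_belowI[of _ 0]) (auto intro: fun_op_norm_nonneg)
    have "\<forall>j<n. 0 \<le> \<xi> j" using \<mu>(1) Q by (simp add: \<xi>_def)
    then show "fun_op_norm m n B \<in> {fun_op_norm m n B |B \<xi>. (\<forall>j<n. 0 \<le> (\<xi> j :: real)) \<and> L2_set \<xi> {..<n} = 1 \<and>
        (\<forall>i<m. \<forall>j<n. Y i j = B i j * complex_of_real (\<xi> j))}"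
      using norm fact by blast
  qed
  ultimately show ?thesis by linarith
qed

lemma cbF_norm_less_imp_dominated:
  assumes "cbF_norm m n Y < sqrt Q" and n: "1 \<le> n"
  shows "dominated m n Y Q"
proof -
  let ?S = "{fun_op_norm m n B |B \<xi>. (\<forall>j<n. 0 \<le> (\<xi> j :: real)) \<and> L2_set \<xi> {..<n} = 1 \<and>
        (\<forall>i<m. \<forall>j<n. Y i j = B i j * complex_of_real (\<xi> j))}"
  \<comment> \<open>The uniform unit vector shows that factorizations exist at all.\<close>
  let ?\<eta> = "\<lambda>_::nat. 1 / sqrt (real n)"
  have "L2_set ?\<eta> {..<n} = 1" using n by (simp add: L2_set_def power_divide)
  moreover have "Y i j = (Y i j / complex_of_real (?\<eta> j)) * complex_of_real (?\<eta> j)" for i j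
    using n by simp
  ultimately have "fun_op_norm m n (\<lambda>i j. Y i j / complex_of_real (?\<eta> j)) \<in> ?S"
    using n by (intro CollectI exI[of _ "\<lambda>i j. Y i j / complex_of_real (?\<eta> j)"] exI[of _ ?\<eta>]) auto
  then have "?S \<noteq> {}" by blast
  from cInf_lessD[OF this assms(1)[unfolded cbF_norm_def]]
  obtain B \<xi> where B: "fun_op_norm m n B < sqrt Q"
    and \<xi>: "L2_set \<xi> {..<n} = 1" "\<And>i j. i < m \<Longrightarrow> j < n \<Longrightarrow> Y i j = B i j * complex_of_real (\<xi> j)"
    by auto
  have Q: "0 < Q" using B fun_op_norm_nonneg[of m n B] by (meson le_less_trans real_sqrt_gt_0_iff)
  show ?thesis unfolding dominated_def
  proof (intro exI[of _ "\<lambda>j. Q * (\<xi> j)\<^sup>2"] conjI allI)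
    show "0 \<le> Q * (\<xi> j)\<^sup>2" for j using Q by simp
    have "(\<Sum>j<n. (\<xi> j)\<^sup>2) = 1" using \<xi>(1) by (simp add: L2_set_def)
    then show "(\<Sum>j<n. Q * (\<xi> j)\<^sup>2) = Q" by (simp add: sum_distrib_left[symmetric])
    fix a
    let ?b = "\<lambda>j. complex_of_real (\<xi> j) * a j"
    have "fun_norm2 m (fun_mult_vec n Y a) = fun_norm2 m (fun_mult_vec n B ?b)"
      using \<xi>(2) by (simp add: fun_norm2_def fun_mult_vec_def L2_set_def mult.assoc)
    also have "\<dots> \<le> fun_op_norm m n B * fun_norm2 n ?b" by (rule fun_norm2_le_op_norm)
    also have "\<dots> \<le> sqrt Q * fun_norm2 n ?b"
      using B by (intro mult_right_mono fun_norm2_nonneg) simp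
    finally have "(fun_norm2 m (fun_mult_vec n Y a))\<^sup>2 \<le> (sqrt Q * fun_norm2 n ?b)\<^sup>2"
      by (intro power_mono fun_norm2_nonneg)
    also have "\<dots> = (\<Sum>j<n. Q * (\<xi> j)\<^sup>2 * (cmod (a j))\<^sup>2)"
      using Q by (simp add: power_mult_distrib fun_norm2_sq norm_mult sum_distrib_left mult.assoc)
    finally show "(fun_norm2 m (fun_mult_vec n Y a))\<^sup>2 \<le> (\<Sum>j<n. Q * (\<xi> j)\<^sup>2 * (cmod (a j))\<^sup>2)" .
  qed
qed

lemma dominated_mono:
  assumes "dominated m n Y Q" "Q \<le> Q'" "1 \<le> n"
  shows "dominated m n Y Q'"
proof -
  obtain \<mu> where \<mu>: "\<And>j. 0 \<le> \<mu> j" "sum \<mu> {..<n} = Q"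
    and dom: "\<And>a. (fun_norm2 m (fun_mult_vec n Y a))\<^sup>2 \<le> (\<Sum>j<n. \<mu> j * (cmod (a j))\<^sup>2)"
    using assms(1) by (auto simp: dominated_def)
  let ?\<nu> = "\<lambda>j. \<mu> j + (if j = 0 then Q' - Q else 0)"
  show ?thesis unfolding dominated_def
  proof (intro exI[of _ ?\<nu>] conjI allI)
    show "0 \<le> ?\<nu> j" for j using \<mu> assms by simp
    show "sum ?\<nu> {..<n} = Q'" using \<mu> assms by (simp add: sum.distrib)
    fix a
    have "(\<Sum>j<n. \<mu> j * (cmod (a j))\<^sup>2) \<le> (\<Sum>j<n. ?\<nu> j * (cmod (a j))\<^sup>2)"
      using assms(2) by (intro sum_mono mult_right_mono) auto
    then show "(fun_norm2 m (fun_mult_vec n Y a))\<^sup>2 \<le> (\<Sum>j<n. ?\<nu> j * (cmod (a j))\<^sup>2)"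
      using dom[of a] by linarith
  qed
qed

section \<open>The little Grothendieck inequality\<close>

text \<open>The instance \<open>c = 9/2\<close> of \<open>|x + y|\<^sup>2 \<le> (1 + c) |x|\<^sup>2 + (1 + 1/c) |y|\<^sup>2\<close>.\<close>

lemma cmod_add_sq_le: "(cmod (x + y))\<^sup>2 \<le> 11 / 2 * (cmod x)\<^sup>2 + 11 / 9 * (cmod y)\<^sup>2"
proof -
  have "(cmod (x + y))\<^sup>2 \<le> (cmod x + cmod y)\<^sup>2"
    by (intro power_mono norm_triangle_ineq) simp
  also have "\<dots> \<le> 11 / 2 * (cmod x)\<^sup>2 + 11 / 9 * (cmod y)\<^sup>2"
    using zero_le_power2[of "9 * cmod x - 2 * cmod y"] by (simp add: power2_eq_square algebra_simps)
  finally show ?thesis .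
qed

text \<open>The vector \<open>4 w\<close> is split into its truncation \<open>sqrt s sgn w\<close>, whose coordinates are bounded by
  \<open>sqrt s\<close> and which is controlled by the norm of \<open>Y\<close> on the max-norm ball, and a remainder, which is
  controlled by the diagonal form.\<close>

lemma truncation_bound:
  assumes \<mu>: "\<And>j. 0 \<le> \<mu> j" and s: "0 \<le> s"
    and dom: "\<And>a. (fun_norm2 m (fun_mult_vec n Y a))\<^sup>2 \<le> (\<Sum>j<n. \<mu> j * (cmod (a j))\<^sup>2)"
  shows "16 * (fun_norm2 m (fun_mult_vec n Y w))\<^sup>2 \<le> 11 / 2 * ((F_norm m n Y)\<^sup>2 * s) +
    11 / 9 * (\<Sum>j<n. \<mu> j * (16 * (cmod (w j))\<^sup>2 - 8 * sqrt s * cmod (w j) + s))"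
proof -
  define z where "z = (\<lambda>j. complex_of_real (sqrt s) * sgn (w j))"
  define u where "u = (\<lambda>j. 4 * w j - z j)"
  have split: "4 * fun_mult_vec n Y w i = fun_mult_vec n Y z i + fun_mult_vec n Y u i" for i
    by (simp add: fun_mult_vec_def u_def sum_distrib_left sum.distrib[symmetric] algebra_simps)
  have "16 * (fun_norm2 m (fun_mult_vec n Y w))\<^sup>2 = (\<Sum>i<m. (cmod (4 * fun_mult_vec n Y w i))\<^sup>2)"
    by (simp add: fun_norm2_sq sum_distrib_left norm_mult power_mult_distrib)
  also have "\<dots> \<le> (\<Sum>i<m. 11 / 2 * (cmod (fun_mult_vec n Y z i))\<^sup>2 + 11 / 9 * (cmod (fun_mult_vec n Y u i))\<^sup>2)"
    unfolding split by (intro sum_mono cmod_add_sq_le)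
  also have "\<dots> = 11 / 2 * (fun_norm2 m (fun_mult_vec n Y z))\<^sup>2 + 11 / 9 * (fun_norm2 m (fun_mult_vec n Y u))\<^sup>2"
    by (simp add: fun_norm2_sq sum.distrib sum_distrib_left)
  finally have main: "16 * (fun_norm2 m (fun_mult_vec n Y w))\<^sup>2 \<le> \<dots>" .
  have "fun_norm2 m (fun_mult_vec n Y z) = sqrt s * fun_norm2 m (fun_mult_vec n Y (\<lambda>j. sgn (w j)))"
    unfolding z_def fun_mult_vec_scale fun_norm2_scale using s by simp
  also have "\<dots> \<le> sqrt s * F_norm m n Y"
    using s by (intro mult_left_mono fun_norm2_le_F_norm) (auto simp: norm_sgn)
  finally have "(fun_norm2 m (fun_mult_vec n Y z))\<^sup>2 \<le> (sqrt s * F_norm m n Y)\<^sup>2"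
    by (intro power_mono fun_norm2_nonneg)
  then have 1: "(fun_norm2 m (fun_mult_vec n Y z))\<^sup>2 \<le> (F_norm m n Y)\<^sup>2 * s"
    using s by (simp add: power_mult_distrib mult.commute)
  have u2: "(cmod (u j))\<^sup>2 \<le> 16 * (cmod (w j))\<^sup>2 - 8 * sqrt s * cmod (w j) + s" for j
  proof (cases "w j = 0")
    case True
    then show ?thesis using s by (simp add: u_def z_def)
  next
    case False
    have "u j = complex_of_real (4 * cmod (w j) - sqrt s) * sgn (w j)"
      using False by (simp add: u_def z_def sgn_eq field_simps)
    then have "cmod (u j) = \<bar>4 * cmod (w j) - sqrt s\<bar>"
      using False by (simp add: norm_mult norm_sgn del: of_real_diff of_real_mult)
    then show ?thesis using s by (simp add: power2_diff power_mult_distrib)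
  qed
  have "(fun_norm2 m (fun_mult_vec n Y u))\<^sup>2 \<le> (\<Sum>j<n. \<mu> j * (cmod (u j))\<^sup>2)" by (rule dom)
  also have "\<dots> \<le> (\<Sum>j<n. \<mu> j * (16 * (cmod (w j))\<^sup>2 - 8 * sqrt s * cmod (w j) + s))"
    by (intro sum_mono mult_left_mono u2 \<mu>)
  finally show ?thesis using main 1 by linarith
qed

text \<open>The self-improvement behind the little Grothendieck inequality. For a weighted family of vectors
  \<open>a\<close>, the truncation bound is averaged over the random vector \<open>W = \<Sum> sqrt (h a) g\<^sub>a a\<close> with
  independent standard Gaussians \<open>g\<^sub>a\<close>. The factor 4 and the constant 9/2 in the preceding
  inequalities are chosen so that the fixed point of the improvement, a bound
  on \<open>Q\<close> in units of the squared norm of \<open>Y\<close>, lies below 2; here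
  \<open>10.76 = 17 - 8 * 0.78\<close> and \<open>11/9 * 10.76 < 13.152\<close>.\<close>

lemma dominated_improve:
  assumes dQ: "dominated m n Y Q" and n: "1 \<le> n"
  shows "dominated m n Y ((11 / 2 * (F_norm m n Y)\<^sup>2 + 13.152 * Q) / 16)"
proof -
  obtain \<mu> where \<mu>: "\<And>j. 0 \<le> \<mu> j" "sum \<mu> {..<n} = Q"
    and dom: "\<And>a. (fun_norm2 m (fun_mult_vec n Y a))\<^sup>2 \<le> (\<Sum>j<n. \<mu> j * (cmod (a j))\<^sup>2)"
    using dQ by (auto simp: dominated_def)
  define c where "c = sqrt (2 / pi)"
  have c: "0.78 \<le> c" "c \<le> 1" unfolding c_def by (rule sqrt_two_over_pi_bounds)+
  have Q: "0 \<le> Q" using \<mu> sum_nonneg[of "{..<n}" \<mu>] by auto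
  let ?M = "(11 / 2 * (F_norm m n Y)\<^sup>2 + 13.152 * Q) / 16"
  show ?thesis unfolding dominated_def
  proof (rule pietsch_domination)
    show "finite {..<n}" "{..<n} \<noteq> {}" "0 \<le> ?M" using n Q by (auto simp: lessThan_empty_iff)
    fix I :: "(nat \<Rightarrow> complex) set" and h s
    assume I: "finite I" and h: "\<And>a. a \<in> I \<Longrightarrow> 0 \<le> h a"
      and le: "\<And>j. j \<in> {..<n} \<Longrightarrow> (\<Sum>a\<in>I. h a * (cmod (a j))\<^sup>2) \<le> s"
    define T where "T = (\<lambda>j. \<Sum>a\<in>I. h a * (cmod (a j))\<^sup>2)"
    have T: "0 \<le> T j" for j unfolding T_def using h by (intro sum_nonneg) auto
    have s: "0 \<le> s" using le[of 0] T[of 0] n by (simp add: T_def)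
    interpret prob_space "gauss_space I" by (rule prob_space_gauss_space)
    define W where "W = (\<lambda>\<omega> j. \<Sum>a\<in>I. complex_of_real (sqrt (h a) * \<omega> a) * a j)"
    have YW: "fun_mult_vec n Y (W \<omega>) i =
        (\<Sum>a\<in>I. complex_of_real (sqrt (h a) * \<omega> a) * fun_mult_vec n Y a i)" for \<omega> i
      unfolding fun_mult_vec_def W_def sum_distrib_left
      by (subst sum.swap) (simp add: mult.left_commute)
    have "\<exists>g. has_bochner_integral (gauss_space I) g (c * sqrt (T j)) \<and> (\<forall>\<omega>. g \<omega> \<le> cmod (W \<omega> j))" for j
      unfolding c_def T_def W_def using gauss_space_complex_abs[OF I h] by simp
    then obtain g where g: "\<And>j. has_bochner_integral (gauss_space I) (g j) (c * sqrt (T j))"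
      "\<And>j \<omega>. g j \<omega> \<le> cmod (W \<omega> j)" by metis
    have sq: "has_bochner_integral (gauss_space I) (\<lambda>\<omega>. (cmod (W \<omega> j))\<^sup>2) (T j)" for j
      unfolding T_def W_def using I h by (rule gauss_space_complex_sq)
    let ?L = "\<lambda>\<omega>. 16 * (\<Sum>i<m. (cmod (fun_mult_vec n Y (W \<omega>) i))\<^sup>2)"
    let ?R = "\<lambda>\<omega>. 11 / 2 * ((F_norm m n Y)\<^sup>2 * s) +
      11 / 9 * (\<Sum>j<n. \<mu> j * (16 * (cmod (W \<omega> j))\<^sup>2 - 8 * sqrt s * g j \<omega> + s))"
    have L: "has_bochner_integral (gauss_space I) ?L
        (16 * (\<Sum>i<m. \<Sum>a\<in>I. h a * (cmod (fun_mult_vec n Y a i))\<^sup>2))"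
      unfolding YW
      by (intro has_bochner_integral_mult_right has_bochner_integral_sum gauss_space_complex_sq I h)
    have const: "has_bochner_integral (gauss_space I) (\<lambda>_. r) r" for r :: real
      by (simp add: has_bochner_integral_iff prob_space)
    have R: "has_bochner_integral (gauss_space I) ?R (11 / 2 * ((F_norm m n Y)\<^sup>2 * s) +
        11 / 9 * (\<Sum>j<n. \<mu> j * (16 * T j - 8 * sqrt s * (c * sqrt (T j)) + s)))"
      by (intro has_bochner_integral_add has_bochner_integral_mult_right has_bochner_integral_sum
          has_bochner_integral_diff const g(1) sq)
    have "?L \<omega> \<le> ?R \<omega>" for \<omega>
    proof -
      have "?L \<omega> \<le> 11 / 2 * ((F_norm m n Y)\<^sup>2 * s) +
        11 / 9 * (\<Sum>j<n. \<mu> j * (16 * (cmod (W \<omega> j))\<^sup>2 - 8 * sqrt s * cmod (W \<omega> j) + s))"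
        using truncation_bound[OF \<mu>(1) s dom, of "W \<omega>"] by (simp add: fun_norm2_sq)
      also have "\<dots> \<le> ?R \<omega>"
        using s g(2) \<mu>(1) by (intro add_left_mono mult_left_mono sum_mono add_right_mono diff_left_mono) auto
      finally show ?thesis .
    qed
    then have "16 * (\<Sum>i<m. \<Sum>a\<in>I. h a * (cmod (fun_mult_vec n Y a i))\<^sup>2) \<le>
        11 / 2 * ((F_norm m n Y)\<^sup>2 * s) + 11 / 9 * (\<Sum>j<n. \<mu> j * (16 * T j - 8 * sqrt s * (c * sqrt (T j)) + s))"
      using integral_mono[of "gauss_space I" ?L ?R] L R by (simp add: has_bochner_integral_iff)
    also have "\<dots> \<le> 11 / 2 * ((F_norm m n Y)\<^sup>2 * s) + 11 / 9 * (\<Sum>j<n. \<mu> j * (10.76 * s))"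
    proof (intro add_left_mono mult_left_mono sum_mono \<mu>(1))
      fix j assume j: "j \<in> {..<n}"
      define p where "p = sqrt s"
      define q where "q = sqrt (T j)"
      have pq: "0 \<le> q" "q \<le> p" "s = p\<^sup>2" "T j = q\<^sup>2"
        using s T[of j] le[OF j] by (auto simp: p_def q_def T_def)
      have "0 \<le> (p - q) * (16 * (p + q) - 8 * c * p)"
      proof (rule mult_nonneg_nonneg)
        have "c * p \<le> 1 * p" using c pq by (intro mult_right_mono) auto
        then show "0 \<le> 16 * (p + q) - 8 * c * p" using pq by simp
      qed (use pq in simp)
      moreover have "0.78 * p\<^sup>2 \<le> c * p\<^sup>2" using c by (intro mult_right_mono) auto
      ultimately have "16 * q\<^sup>2 - 8 * p * (c * q) + p\<^sup>2 \<le> 10.76 * p\<^sup>2"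
        by (simp add: power2_eq_square algebra_simps)
      from this[folded pq(3,4)]
      show "16 * T j - 8 * sqrt s * (c * sqrt (T j)) + s \<le> 10.76 * s"
        unfolding p_def q_def .
    qed simp
    also have "\<dots> = (11 / 2 * (F_norm m n Y)\<^sup>2 + 11 / 9 * 10.76 * Q) * s"
      unfolding sum_distrib_right[symmetric] \<mu>(2) by (simp add: algebra_simps)
    also have "\<dots> \<le> (11 / 2 * (F_norm m n Y)\<^sup>2 + 13.152 * Q) * s"
      using Q s by (intro mult_right_mono add_left_mono) auto
    finally have "(\<Sum>i<m. \<Sum>a\<in>I. h a * (cmod (fun_mult_vec n Y a i))\<^sup>2) \<le> ?M * s" by simp
    then show "(\<Sum>a\<in>I. h a * (fun_norm2 m (fun_mult_vec n Y a))\<^sup>2) \<le> ?M * s"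
      unfolding fun_norm2_sq sum_distrib_left by (subst sum.swap)
  qed
qed

lemma dominated_exists: "\<exists>Q. dominated m n Y Q"
proof -
  let ?r = "\<lambda>i. \<Sum>j<n. (cmod (Y i j))\<^sup>2"
  have "(fun_norm2 m (fun_mult_vec n Y a))\<^sup>2 \<le> (\<Sum>j<n. (\<Sum>i<m. ?r i) * (cmod (a j))\<^sup>2)" for a
  proof -
    have "(cmod (fun_mult_vec n Y a i))\<^sup>2 \<le> ?r i * (\<Sum>j<n. (cmod (a j))\<^sup>2)" for i
    proof -
      have "cmod (fun_mult_vec n Y a i) \<le> (\<Sum>j<n. cmod (Y i j) * cmod (a j))"
        unfolding fun_mult_vec_def by (rule order_trans[OF norm_sum]) (simp add: norm_mult)
      then have "(cmod (fun_mult_vec n Y a i))\<^sup>2 \<le> (\<Sum>j<n. cmod (Y i j) * cmod (a j))\<^sup>2"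
        by (intro power_mono) auto
      also have "\<dots> \<le> ?r i * (\<Sum>j<n. (cmod (a j))\<^sup>2)" by (rule Cauchy_Schwarz_ineq_sum)
      finally show ?thesis .
    qed
    then have "(fun_norm2 m (fun_mult_vec n Y a))\<^sup>2 \<le> (\<Sum>i<m. ?r i * (\<Sum>j<n. (cmod (a j))\<^sup>2))"
      unfolding fun_norm2_sq by (intro sum_mono)
    then show ?thesis by (simp add: sum_distrib_left[symmetric] sum_distrib_right[symmetric])
  qed
  then show ?thesis unfolding dominated_def
    by (intro exI[of _ "sum (\<lambda>_. \<Sum>i<m. ?r i) {..<n}"] exI[of _ "\<lambda>_. \<Sum>i<m. ?r i"])
      (auto intro!: sum_nonneg)
qed

lemma Inf_self_improving:
  fixes S :: "real set"
  assumes "S \<noteq> {}" "0 \<le> b" "b < 1" and le: "\<And>x. x \<in> S \<Longrightarrow> Inf S \<le> a + b * x"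
  shows "Inf S \<le> a / (1 - b)"
proof (cases "b = 0")
  case True
  then show ?thesis using assms by auto
next
  case False
  then have b: "0 < b" using assms by simp
  have "(Inf S - a) / b \<le> Inf S"
    using assms(1)
  proof (rule cInf_greatest)
    show "(Inf S - a) / b \<le> x" if "x \<in> S" for x
      using le[OF that] b by (simp add: divide_le_eq mult.commute)
  qed
  then show ?thesis using b assms(3) by (simp add: field_simps)
qed

lemma dominated_nonneg: "dominated m n Y Q \<Longrightarrow> 0 \<le> Q"
  by (auto simp: dominated_def intro: sum_nonneg)

lemma dominated_of_F_norm:
  assumes n: "1 \<le> n" and Q: "1.94 * (F_norm m n Y)\<^sup>2 < Q"
  shows "dominated m n Y Q"
proof -
  let ?S = "{Q. dominated m n Y Q}"
  have ne: "?S \<noteq> {}" using dominated_exists[of m n Y] by simp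
  have bdd: "bdd_below ?S" by (rule bdd_belowI[of _ 0]) (auto dest: dominated_nonneg)
  have "Inf ?S \<le> (11 / 32 * (F_norm m n Y)\<^sup>2) / (1 - 0.822)"
  proof (rule Inf_self_improving[OF ne])
    show "Inf ?S \<le> 11 / 32 * (F_norm m n Y)\<^sup>2 + 0.822 * x" if "x \<in> ?S" for x
    proof -
      have "Inf ?S \<le> (11 / 2 * (F_norm m n Y)\<^sup>2 + 13.152 * x) / 16"
        using dominated_improve[OF _ n] that by (intro cInf_lower bdd CollectI) blast
      then show ?thesis by simp
    qed
  qed auto
  also have "\<dots> \<le> 1.94 * (F_norm m n Y)\<^sup>2" by simp
  finally have "Inf ?S < Q" using Q by simp
  from cInf_lessD[OF ne this] show ?thesis using dominated_mono[OF _ _ n] by auto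
qed

lemma cbF_norm_le_1_94:
  assumes n: "1 \<le> n"
  shows "cbF_norm m n Y \<le> sqrt 1.94 * F_norm m n Y"
proof (rule ccontr)
  define r where "r = sqrt 1.94 * F_norm m n Y"
  assume "\<not> ?thesis"
  then have lt: "r < cbF_norm m n Y" by (simp add: r_def)
  define t where "t = (r + cbF_norm m n Y) / 2"
  have r: "0 \<le> r" by (simp add: r_def F_norm_nonneg)
  have t: "r < t" "t < cbF_norm m n Y" using lt by (auto simp: t_def)
  have "r\<^sup>2 < t\<^sup>2" using r t by (intro power_strict_mono) auto
  then have "dominated m n Y (t\<^sup>2)"
    by (intro dominated_of_F_norm n) (simp add: r_def power_mult_distrib)
  then have "cbF_norm m n Y \<le> sqrt (t\<^sup>2)" using r t by (intro dominated_imp_cbF_norm_le) auto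
  then show False using r t by simp
qed

text \<open>The infimum that defines the constant is taken over a nonempty closed set, hence is attained,
  and the constant is smaller than 2.\<close>

lemma little_grothendieck_le: "little_grothendieck_complex \<le> 1.94"
  and little_grothendieck_nonneg: "0 \<le> little_grothendieck_complex"
  and little_grothendieck_cbF_norm_le:
    "1 \<le> m \<Longrightarrow> 1 \<le> n \<Longrightarrow> cbF_norm m n Y \<le> sqrt little_grothendieck_complex * F_norm m n Y"
proof -
  let ?S = "{k. 0 \<le> k \<and> (\<forall>m\<ge>1. \<forall>n\<ge>1. \<forall>Y. cbF_norm m n Y \<le> sqrt k * F_norm m n Y)}"
  have in_S: "1.94 \<in> ?S" using cbF_norm_le_1_94 by auto
  have bdd: "bdd_below ?S" by (rule bdd_belowI[of _ 0]) auto
  have "closed ?S"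
    by (intro closed_Collect_conj closed_Collect_all closed_Collect_imp open_Collect_const
        closed_Collect_le continuous_intros)
  then have "Inf ?S \<in> ?S" using closed_contains_Inf[OF _ bdd] in_S by blast
  then show "0 \<le> little_grothendieck_complex"
    "1 \<le> m \<Longrightarrow> 1 \<le> n \<Longrightarrow> cbF_norm m n Y \<le> sqrt little_grothendieck_complex * F_norm m n Y"
    unfolding little_grothendieck_complex_def by blast+
  show "little_grothendieck_complex \<le> 1.94"
    unfolding little_grothendieck_complex_def using in_S bdd by (rule cInf_lower)
qed

lemma little_grothendieck_dominated:
  assumes "1 \<le> m" "1 \<le> n" "little_grothendieck_complex * (F_norm m n Y)\<^sup>2 < Q"
  shows "dominated m n Y Q"
proof (rule cbF_norm_less_imp_dominated)
  have "cbF_norm m n Y \<le> sqrt (little_grothendieck_complex * (F_norm m n Y)\<^sup>2)"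
    using little_grothendieck_cbF_norm_le[OF assms(1,2), of Y] F_norm_nonneg[of m n Y]
    by (simp add: real_sqrt_mult)
  also have "\<dots> < sqrt Q" using assms(3) by simp
  finally show "cbF_norm m n Y < sqrt Q" .
qed fact

lemma little_grothendieck_ge_1: "1 \<le> little_grothendieck_complex"
proof (rule ccontr)
  let ?k = little_grothendieck_complex and ?Y = "\<lambda>_ _. 1 :: complex"
  assume "\<not> 1 \<le> ?k"
  have eq: "fun_norm2 1 (fun_mult_vec 1 ?Y a) = cmod (a 0)" for a
    by (simp add: fun_norm2_def fun_mult_vec_def L2_set_def lessThan_Suc)
  have "F_norm 1 1 ?Y \<le> 1"
  proof (rule F_norm_leI)
    show "fun_norm2 1 (fun_mult_vec 1 ?Y x) \<le> 1" if "\<And>j. j < 1 \<Longrightarrow> cmod (x j) \<le> 1" for x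
      unfolding eq using that[of 0] by simp
  qed simp
  then have "(F_norm 1 1 ?Y)\<^sup>2 \<le> 1" by (simp add: power_le_one F_norm_nonneg)
  then have "?k * (F_norm 1 1 ?Y)\<^sup>2 \<le> ?k * 1"
    by (intro mult_left_mono little_grothendieck_nonneg)
  then have "dominated 1 1 ?Y ((?k + 1) / 2)"
    using \<open>\<not> 1 \<le> ?k\<close> by (intro little_grothendieck_dominated) auto
  then obtain \<mu> :: "nat \<Rightarrow> real" where "\<mu> 0 = (?k + 1) / 2"
    and dom: "\<And>a. (fun_norm2 1 (fun_mult_vec 1 ?Y a))\<^sup>2 \<le> \<mu> 0 * (cmod (a 0))\<^sup>2"
    by (auto simp: dominated_def)
  moreover have "1 \<le> \<mu> 0" using dom[of "\<lambda>_. 1"] unfolding eq by simp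
  ultimately show False using \<open>\<not> 1 \<le> ?k\<close> by simp
qed

text \<open>The little Grothendieck inequality as a domination, with the coordinates indexed by an arbitrary
  finite type instead of an initial segment of the natural numbers.\<close>

lemma little_grothendieck_finite_type:
  fixes Y :: "'a::finite \<Rightarrow> 'a \<Rightarrow> complex"
  assumes G: "\<And>x. (\<And>j. cmod (x j) \<le> 1) \<Longrightarrow> (\<Sum>k\<in>UNIV. (cmod (\<Sum>j\<in>UNIV. Y k j * x j))\<^sup>2) \<le> G"
    and Q: "little_grothendieck_complex * G < Q"
  shows "\<exists>\<mu>. (\<forall>j. 0 \<le> \<mu> j) \<and> sum \<mu> UNIV = Q \<and>
    (\<forall>a. (\<Sum>k\<in>UNIV. (cmod (\<Sum>j\<in>UNIV. Y k j * a j))\<^sup>2) \<le> (\<Sum>j\<in>UNIV. \<mu> j * (cmod (a j))\<^sup>2))"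
proof -
  define N where "N = CARD('a)"
  obtain e :: "nat \<Rightarrow> 'a" where e: "bij_betw e {..<N} UNIV"
    using ex_bij_betw_nat_finite[of "UNIV :: 'a set"] by (auto simp: N_def atLeast0LessThan)
  define f where "f = the_inv_into {..<N} e"
  have fe: "f (e i) = i" if "i < N" for i
    using e that by (auto simp: f_def bij_betw_def intro!: the_inv_into_f_f)
  have sum_e: "(\<Sum>i<N. \<phi> (e i)) = (\<Sum>j\<in>UNIV. \<phi> j)" for \<phi> :: "'a \<Rightarrow> 'b::comm_monoid_add"
    using sum.reindex_bij_betw[OF e] .
  define Y' where "Y' = (\<lambda>i j. Y (e i) (e j))"
  have eq: "(fun_norm2 N (fun_mult_vec N Y' x))\<^sup>2 = (\<Sum>k\<in>UNIV. (cmod (\<Sum>j\<in>UNIV. Y k j * x (f j)))\<^sup>2)" for x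
  proof -
    have "fun_mult_vec N Y' x i = (\<Sum>j\<in>UNIV. Y (e i) j * x (f j))" for i
      unfolding fun_mult_vec_def Y'_def
      using sum_e[of "\<lambda>j. Y (e i) j * x (f j)"] by (simp add: fe)
    then show ?thesis
      using sum_e[of "\<lambda>k. (cmod (\<Sum>j\<in>UNIV. Y k j * x (f j)))\<^sup>2"] by (simp add: fun_norm2_sq)
  qed
  have f_less: "f j < N" for j
    using e the_inv_into_into[of e "{..<N}" j "{..<N}"] by (auto simp: f_def bij_betw_def)
  have G0: "0 \<le> G" using G[of "\<lambda>_. 0"] by simp
  have "F_norm N N Y' \<le> sqrt G"
  proof (rule F_norm_leI)
    fix x assume x: "\<And>j. j < N \<Longrightarrow> cmod (x j) \<le> 1"
    have "(fun_norm2 N (fun_mult_vec N Y' x))\<^sup>2 \<le> G"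
      unfolding eq using x f_less by (intro G) auto
    then show "fun_norm2 N (fun_mult_vec N Y' x) \<le> sqrt G" by (rule real_le_rsqrt)
  qed (use G0 in simp)
  then have "(F_norm N N Y')\<^sup>2 \<le> (sqrt G)\<^sup>2" by (intro power_mono F_norm_nonneg)
  then have "little_grothendieck_complex * (F_norm N N Y')\<^sup>2 \<le> little_grothendieck_complex * G"
    using G0 by (intro mult_left_mono little_grothendieck_nonneg) auto
  moreover have "1 \<le> N" by (simp add: N_def Suc_leI)
  ultimately have "dominated N N Y' Q" using Q by (intro little_grothendieck_dominated) auto
  then obtain \<mu> where \<mu>: "\<And>j. 0 \<le> \<mu> j" "sum \<mu> {..<N} = Q"
    and dom: "\<And>a. (fun_norm2 N (fun_mult_vec N Y' a))\<^sup>2 \<le> (\<Sum>j<N. \<mu> j * (cmod (a j))\<^sup>2)"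
    by (auto simp: dominated_def)
  have ef: "e (f j) = j" for j
    using e f_the_inv_into_f[of e "{..<N}" j] by (auto simp: f_def bij_betw_def)
  show ?thesis
  proof (intro exI[of _ "\<lambda>j. \<mu> (f j)"] conjI allI)
    show "0 \<le> \<mu> (f j)" for j by (rule \<mu>)
    show "(\<Sum>j\<in>UNIV. \<mu> (f j)) = Q"
      using sum_e[of "\<lambda>j. \<mu> (f j)"] \<mu>(2) by (simp add: fe)
    fix a :: "'a \<Rightarrow> complex"
    have "(\<Sum>k\<in>UNIV. (cmod (\<Sum>j\<in>UNIV. Y k j * a j))\<^sup>2) = (fun_norm2 N (fun_mult_vec N Y' (\<lambda>i. a (e i))))\<^sup>2"
      unfolding eq by (simp add: ef)
    also have "\<dots> \<le> (\<Sum>j<N. \<mu> j * (cmod (a (e j)))\<^sup>2)" by (rule dom)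
    also have "\<dots> = (\<Sum>j\<in>UNIV. \<mu> (f j) * (cmod (a j))\<^sup>2)"
      using sum_e[of "\<lambda>j. \<mu> (f j) * (cmod (a j))\<^sup>2"] by (simp add: fe)
    finally show "(\<Sum>k\<in>UNIV. (cmod (\<Sum>j\<in>UNIV. Y k j * a j))\<^sup>2) \<le> (\<Sum>j\<in>UNIV. \<mu> (f j) * (cmod (a j))\<^sup>2)" .
  qed
qed

section \<open>Positive semidefinite forms\<close>

text \<open>A positive semidefinite Hermitian form is a sum of squared moduli of linear forms (Cholesky
  decomposition): remove one index \<open>p\<close> at a time and pass to the Schur complement \<open>H'\<close>.\<close>

lemma psd_imp_gram:
  fixes H :: "'a \<Rightarrow> 'a \<Rightarrow> complex"
  assumes "finite J" and herm: "\<And>i j. H j i = cnj (H i j)"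
    and psd: "\<And>a. 0 \<le> Re (\<Sum>i\<in>J. \<Sum>j\<in>J. cnj (a i) * H i j * a j)"
  shows "\<exists>Y. \<forall>a. Re (\<Sum>i\<in>J. \<Sum>j\<in>J. cnj (a i) * H i j * a j) =
           (\<Sum>k\<in>J. (cmod (\<Sum>j\<in>J. Y k j * a j))\<^sup>2)"
  using assms
proof (induction J arbitrary: H rule: finite_induct)
  case empty
  show ?case by simp
next
  case (insert p J H)
  note herm = insert.prems(1)
  let ?Q = "\<lambda>H a. Re (\<Sum>i\<in>J. \<Sum>j\<in>J. cnj (a i) * H i j * a j)"
  define L where "L = (\<lambda>a. \<Sum>j\<in>J. H p j * a j)"
  define r where "r = Re (H p p)"
  have "Im (H p p) = 0" using arg_cong[OF herm[of p p], of Im] by simp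
  then have Hpp: "H p p = complex_of_real r" by (simp add: r_def complex_eq_iff)
  have col: "(\<Sum>i\<in>J. cnj (a i) * H i p * a p) = cnj (cnj (a p) * L a)" for a
    unfolding L_def by (simp add: sum_distrib_left herm[of _ p] mult_ac)
  have exp: "Re (\<Sum>i\<in>insert p J. \<Sum>j\<in>insert p J. cnj (a i) * H i j * a j) =
      r * (cmod (a p))\<^sup>2 + 2 * Re (cnj (a p) * L a) + ?Q H a" for a
  proof -
    have "(\<Sum>i\<in>insert p J. \<Sum>j\<in>insert p J. cnj (a i) * H i j * a j) =
      cnj (a p) * H p p * a p + cnj (a p) * L a +
      ((\<Sum>i\<in>J. cnj (a i) * H i p * a p) + (\<Sum>i\<in>J. \<Sum>j\<in>J. cnj (a i) * H i j * a j))"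
      using insert.hyps by (simp add: sum.distrib L_def sum_distrib_left mult.assoc)
    moreover have "Re (cnj (a p) * H p p * a p) = r * (cmod (a p))\<^sup>2"
      unfolding Hpp cmod_power2 by (simp add: power2_eq_square algebra_simps)
    ultimately show ?thesis unfolding col by simp
  qed
  have Lp: "L (a(p := t)) = L a" and Qp: "?Q H (a(p := t)) = ?Q H a" for a t
    using insert.hyps unfolding L_def by (auto intro!: sum.cong arg_cong[where f = Re])
  have pos: "0 \<le> r * (cmod t)\<^sup>2 + 2 * Re (cnj t * L a) + ?Q H a" for a t
    using insert.prems(2)[of "a(p := t)"] unfolding exp Lp Qp by simp
  have r: "0 \<le> r" using pos[of 1 "\<lambda>_. 0"] by (simp add: L_def)
  \<comment> \<open>A vanishing diagonal entry forces its row to vanish. Division by \<open>r = 0\<close> below then does no harm.\<close>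
  have L0: "L a = 0" if "r = 0" for a
  proof (rule ccontr)
    assume "L a \<noteq> 0"
    define c where "c = (?Q H a + 1) / (2 * (cmod (L a))\<^sup>2)"
    have "Re (cnj (- complex_of_real c * L a) * L a) = - c * (cmod (L a))\<^sup>2"
      unfolding cmod_power2 by (simp add: power2_eq_square algebra_simps)
    moreover have "2 * (c * (cmod (L a))\<^sup>2) = ?Q H a + 1"
      using \<open>L a \<noteq> 0\<close> by (simp add: c_def)
    ultimately show False using pos[of "- complex_of_real c * L a" a] that by simp
  qed
  define H' where "H' = (\<lambda>i j. H i j - cnj (H p i) * H p j / complex_of_real r)"
  have Q': "?Q H' a = ?Q H a - (cmod (L a))\<^sup>2 / r" for a
  proof -
    have "(\<Sum>i\<in>J. \<Sum>j\<in>J. cnj (a i) * (cnj (H p i) * H p j / complex_of_real r) * a j) =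
        cnj (L a) * L a / complex_of_real r"
      unfolding L_def cnj_sum sum_product sum_divide_distrib by (intro sum.cong refl) simp
    also have "\<dots> = complex_of_real ((cmod (L a))\<^sup>2 / r)"
      unfolding of_real_divide complex_norm_square by (simp add: mult.commute)
    finally show ?thesis unfolding H'_def
      by (simp add: right_diff_distrib left_diff_distrib sum_subtractf)
  qed
  have "\<exists>Y. \<forall>a. ?Q H' a = (\<Sum>k\<in>J. (cmod (\<Sum>j\<in>J. Y k j * a j))\<^sup>2)"
  proof (rule insert.IH)
    show "H' j i = cnj (H' i j)" for i j
      using herm[of i j] by (simp add: H'_def mult.commute)
    show "0 \<le> ?Q H' a" for a
    proof (cases "r = 0")
      case True
      then show ?thesis unfolding Q' using pos[of 0 a] by simp
    next
      case False
      have "Re (cnj (- L a / complex_of_real r) * L a) = - ((cmod (L a))\<^sup>2 / r)"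
        unfolding cmod_power2 by (simp add: power2_eq_square add_divide_distrib)
      moreover have "r * (cmod (- L a / complex_of_real r))\<^sup>2 = (cmod (L a))\<^sup>2 / r"
        using False by (simp add: norm_divide power2_eq_square)
      ultimately show ?thesis unfolding Q' using pos[of "- L a / complex_of_real r" a] by linarith
    qed
  qed
  then obtain Y where Y: "\<And>a. ?Q H' a = (\<Sum>k\<in>J. (cmod (\<Sum>j\<in>J. Y k j * a j))\<^sup>2)" by blast
  let ?s = "complex_of_real (sqrt r)"
  define Z where "Z = (\<lambda>k j. if k = p then if j = p then ?s else H p j / ?s
                          else if j = p then 0 else Y k j)"
  have "Re (\<Sum>i\<in>insert p J. \<Sum>j\<in>insert p J. cnj (a i) * H i j * a j) =
      (\<Sum>k\<in>insert p J. (cmod (\<Sum>j\<in>insert p J. Z k j * a j))\<^sup>2)" for a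
  proof -
    have "(\<Sum>j\<in>J. Z p j * a j) = L a / ?s"
      unfolding L_def Z_def sum_divide_distrib using insert.hyps by (intro sum.cong) auto
    then have row: "(\<Sum>j\<in>insert p J. Z p j * a j) = ?s * a p + L a / ?s"
      using insert.hyps by (simp add: Z_def)
    have "(\<Sum>j\<in>insert p J. Z k j * a j) = (\<Sum>j\<in>J. Y k j * a j)" if "k \<in> J" for k
    proof -
      have "(\<Sum>j\<in>J. Z k j * a j) = (\<Sum>j\<in>J. Y k j * a j)"
        using insert.hyps that by (intro sum.cong) (auto simp: Z_def)
      moreover have "Z k p = 0" using insert.hyps that by (auto simp: Z_def)
      ultimately show ?thesis using insert.hyps by simp
    qed
    then have "(\<Sum>k\<in>insert p J. (cmod (\<Sum>j\<in>insert p J. Z k j * a j))\<^sup>2) =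
        (cmod (?s * a p + L a / ?s))\<^sup>2 + ?Q H' a"
      unfolding Y sum.insert[OF insert.hyps] using row insert.hyps by simp
    also have "(cmod (?s * a p + L a / ?s))\<^sup>2 =
        r * (cmod (a p))\<^sup>2 + 2 * Re (cnj (a p) * L a) + (cmod (L a))\<^sup>2 / r"
    proof (cases "r = 0")
      case True
      then show ?thesis using L0 by simp
    next
      case False
      then have "0 < sqrt r" "r = sqrt r * sqrt r" using r by auto
      then show ?thesis
        unfolding cmod_power2 by (simp add: power2_eq_square field_simps)
    qed
    finally show ?thesis unfolding exp Q' by simp
  qed
  then show ?case by blast
qed

section \<open>Schur multipliers and dominated bilinear forms\<close>

lemma norm_vec_sq: "(norm (x :: complex^'n))\<^sup>2 = (\<Sum>i\<in>UNIV. (cmod (x $ i))\<^sup>2)"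
  by (simp add: norm_vec_def L2_set_def sum_nonneg)

lemma onorm_le_sum_norms:
  fixes A :: "complex^'n^'m"
  shows "onorm ((*v) A) \<le> (\<Sum>i\<in>UNIV. \<Sum>j\<in>UNIV. cmod (A $ i $ j))"
proof (rule onorm_bound)
  fix x :: "complex^'n"
  have "norm (A *v x) \<le> (\<Sum>i\<in>UNIV. cmod ((A *v x) $ i))"
    unfolding norm_vec_def by (rule L2_set_le_sum) simp
  also have "\<dots> \<le> (\<Sum>i\<in>UNIV. \<Sum>j\<in>UNIV. cmod (A $ i $ j) * norm x)"
  proof (rule sum_mono)
    fix i
    have "cmod ((A *v x) $ i) \<le> (\<Sum>j\<in>UNIV. cmod (A $ i $ j * x $ j))"
      unfolding matrix_vector_mult_def by (simp add: norm_sum)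
    also have "\<dots> \<le> (\<Sum>j\<in>UNIV. cmod (A $ i $ j) * norm x)"
      unfolding norm_mult by (intro sum_mono mult_left_mono Finite_Cartesian_Product.norm_nth_le) auto
    finally show "cmod ((A *v x) $ i) \<le> (\<Sum>j\<in>UNIV. cmod (A $ i $ j) * norm x)" .
  qed
  finally show "norm (A *v x) \<le> (\<Sum>i\<in>UNIV. \<Sum>j\<in>UNIV. cmod (A $ i $ j)) * norm x"
    by (simp add: sum_distrib_right)
qed (intro sum_nonneg, simp)

lemma onorm_entry_le:
  fixes A :: "complex^'n^'m"
  shows "cmod (A $ i $ j) \<le> onorm ((*v) A)"
proof -
  have "cmod (A $ i $ j) = cmod ((A *v axis j 1) $ i)"
    by (simp add: matrix_vector_mult_def axis_def if_distrib[of "\<lambda>x. _ * x"] cong: if_cong)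
  also have "\<dots> \<le> norm (A *v axis j 1)" by (rule Finite_Cartesian_Product.norm_nth_le)
  also have "\<dots> \<le> onorm ((*v) A) * norm (axis j (1::complex))"
    by (intro onorm matrix_vector_mul_bounded_linear)
  finally show ?thesis by simp
qed

lemma onorm_schur_product_le_schur_norm:
  fixes X A :: "complex^'n^'m"
  assumes "onorm ((*v) A) \<le> 1"
  shows "onorm ((*v) (X \<circ>\<^sub>S A)) \<le> schur_norm X"
  unfolding schur_norm_def
proof (rule cSup_upper)
  have "onorm ((*v) (X \<circ>\<^sub>S A)) \<le> (\<Sum>i\<in>UNIV. \<Sum>j\<in>UNIV. cmod (X $ i $ j))"
    if A: "onorm ((*v) A) \<le> 1" for A :: "complex^'n^'m"
  proof -
    have "onorm ((*v) (X \<circ>\<^sub>S A)) \<le> (\<Sum>i\<in>UNIV. \<Sum>j\<in>UNIV. cmod ((X \<circ>\<^sub>S A) $ i $ j))"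
      by (rule onorm_le_sum_norms)
    also have "\<dots> \<le> (\<Sum>i\<in>UNIV. \<Sum>j\<in>UNIV. cmod (X $ i $ j))"
      using order_trans[OF onorm_entry_le A]
      by (intro sum_mono) (simp add: schur_product_def norm_mult mult_left_le)
    finally show ?thesis .
  qed
  then show "bdd_above {onorm ((*v) (X \<circ>\<^sub>S A)) |A. onorm ((*v) A) \<le> 1}"
    by (intro bdd_aboveI) auto
qed (use assms in blast)

text \<open>The bilinear form of \<open>A\<close> is dominated by a diagonal form of total mass \<open>M\<close>. Equivalently, the
  Hermitian matrix with diagonal \<open>(l, t)\<close> and off-diagonal blocks \<open>A\<close> and \<open>A*\<close> is positive
  semidefinite.\<close>

definition form_dominated :: "('m::finite \<Rightarrow> 'n::finite \<Rightarrow> complex) \<Rightarrow> real \<Rightarrow> bool"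
  where "form_dominated A M \<longleftrightarrow> (\<exists>l t. (\<forall>i. 0 \<le> l i) \<and> (\<forall>j. 0 \<le> t j) \<and> sum l UNIV + sum t UNIV = M \<and>
    (\<forall>p q. 2 * Re (\<Sum>i\<in>UNIV. \<Sum>j\<in>UNIV. A i j * p i * q j) \<le>
       (\<Sum>i\<in>UNIV. l i * (cmod (p i))\<^sup>2) + (\<Sum>j\<in>UNIV. t j * (cmod (q j))\<^sup>2)))"

text \<open>Domination of \<open>A\<close> means that \<open>A = diag u B diag v\<close> with \<open>u\<^sub>i\<^sup>2 = l\<^sub>i\<close>, \<open>v\<^sub>j\<^sup>2 = t\<^sub>j\<close> and \<open>B\<close> a
  contraction. Then pairing \<open>A\<close> with \<open>X\<close> is evaluating the Schur product of \<open>X\<close> and \<open>B\<close> at the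
  vectors \<open>v\<close> and \<open>u\<close>.\<close>

lemma form_dominated_imp_pairing_le:
  fixes X :: "complex^'n^'m"
  assumes X: "schur_norm X \<le> 1" and "form_dominated A M"
  shows "2 * Re (\<Sum>i\<in>UNIV. \<Sum>j\<in>UNIV. A i j * X $ i $ j) \<le> M"
proof -
  obtain l :: "'m \<Rightarrow> real" and t :: "'n \<Rightarrow> real"
    where l: "\<And>i. 0 \<le> l i" and t: "\<And>j. 0 \<le> t j" and M: "sum l UNIV + sum t UNIV = M"
    and dom: "\<And>p q. 2 * Re (\<Sum>i\<in>UNIV. \<Sum>j\<in>UNIV. A i j * p i * q j) \<le>
       (\<Sum>i\<in>UNIV. l i * (cmod (p i))\<^sup>2) + (\<Sum>j\<in>UNIV. t j * (cmod (q j))\<^sup>2)"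
    using assms(2) unfolding form_dominated_def by blast
  let ?P = "Re (\<Sum>i\<in>UNIV. \<Sum>j\<in>UNIV. A i j * X $ i $ j)"
  \<comment> \<open>Adding \<open>e\<close> to all weights makes them invertible.\<close>
  have approx: "2 * ?P \<le> M + e * (CARD('m) + CARD('n))" if e: "0 < e" for e :: real
  proof -
    define u where "u = (\<lambda>i. sqrt (l i + e))"
    define v where "v = (\<lambda>j. sqrt (t j + e))"
    have u: "0 < u i" "(u i)\<^sup>2 = l i + e" for i using l[of i] e by (auto simp: u_def)
    have v: "0 < v j" "(v j)\<^sup>2 = t j + e" for j using t[of j] e by (auto simp: v_def)
    define B :: "complex^'n^'m" where "B = (\<chi> i j. A i j / complex_of_real (u i * v j))"
    \<comment> \<open>With \<open>y = B x\<close>, domination at \<open>(cnj y / u, x / v)\<close> yields \<open>2 |y|\<^sup>2 \<le> |y|\<^sup>2 + |x|\<^sup>2\<close>.\<close>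
    have "onorm ((*v) B) \<le> 1"
    proof (rule onorm_bound)
      fix x :: "complex^'n"
      define y where "y = B *v x"
      let ?p = "\<lambda>i. cnj (y $ i) / complex_of_real (u i)" and ?q = "\<lambda>j. x $ j / complex_of_real (v j)"
      have "complex_of_real ((norm y)\<^sup>2) = (\<Sum>i\<in>UNIV. cnj (y $ i) * y $ i)"
        unfolding norm_vec_sq of_real_sum complex_norm_square by (simp add: mult.commute)
      also have "\<dots> = (\<Sum>i\<in>UNIV. \<Sum>j\<in>UNIV. A i j * ?p i * ?q j)"
      proof (rule sum.cong)
        fix i
        have yi: "y $ i = (\<Sum>j\<in>UNIV. A i j / complex_of_real (u i * v j) * x $ j)"
          by (simp add: y_def B_def matrix_vector_mult_def)
        show "cnj (y $ i) * y $ i = (\<Sum>j\<in>UNIV. A i j * ?p i * ?q j)"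
          by (subst (2) yi) (simp add: sum_distrib_left mult_ac)
      qed simp
      finally have "2 * (norm y)\<^sup>2 = 2 * Re (\<Sum>i\<in>UNIV. \<Sum>j\<in>UNIV. A i j * ?p i * ?q j)"
        by (metis Re_complex_of_real)
      also have "\<dots> \<le> (\<Sum>i\<in>UNIV. l i * (cmod (?p i))\<^sup>2) + (\<Sum>j\<in>UNIV. t j * (cmod (?q j))\<^sup>2)"
        by (rule dom)
      also have "\<dots> \<le> (\<Sum>i\<in>UNIV. (cmod (y $ i))\<^sup>2) + (\<Sum>j\<in>UNIV. (cmod (x $ j))\<^sup>2)"
      proof (intro add_mono sum_mono)
        show "l i * (cmod (?p i))\<^sup>2 \<le> (cmod (y $ i))\<^sup>2" for i
        proof -
          have "l i * (cmod (?p i))\<^sup>2 \<le> (u i)\<^sup>2 * (cmod (?p i))\<^sup>2"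
            using u(2)[of i] e by (intro mult_right_mono) auto
          then show ?thesis using u(1)[of i] by (simp add: norm_divide power_divide)
        qed
        show "t j * (cmod (?q j))\<^sup>2 \<le> (cmod (x $ j))\<^sup>2" for j
        proof -
          have "t j * (cmod (?q j))\<^sup>2 \<le> (v j)\<^sup>2 * (cmod (?q j))\<^sup>2"
            using v(2)[of j] e by (intro mult_right_mono) auto
          then show ?thesis using v(1)[of j] by (simp add: norm_divide power_divide)
        qed
      qed
      also have "\<dots> = (norm y)\<^sup>2 + (norm x)\<^sup>2" by (simp add: norm_vec_sq)
      finally have "(norm y)\<^sup>2 \<le> (norm x)\<^sup>2" by simp
      then show "norm (B *v x) \<le> 1 * norm x" by (simp add: y_def)
    qed simp
    then have "onorm ((*v) (X \<circ>\<^sub>S B)) \<le> 1"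
      using onorm_schur_product_le_schur_norm[of B X] X by linarith
    define V :: "complex^'n" where "V = (\<chi> j. complex_of_real (v j))"
    define w where "w = (X \<circ>\<^sub>S B) *v V"
    have "norm w \<le> onorm ((*v) (X \<circ>\<^sub>S B)) * norm V"
      unfolding w_def by (intro onorm matrix_vector_mul_bounded_linear)
    also have "\<dots> \<le> 1 * norm V"
      by (intro mult_right_mono) (use \<open>onorm ((*v) (X \<circ>\<^sub>S B)) \<le> 1\<close> in auto)
    finally have wV: "(norm w)\<^sup>2 \<le> (norm V)\<^sup>2" by simp
    have "(\<Sum>j\<in>UNIV. A i j * X $ i $ j) = complex_of_real (u i) * w $ i" for i
    proof -
      have "complex_of_real (u i) * w $ i =
          (\<Sum>j\<in>UNIV. complex_of_real (u i) * (X $ i $ j * (A i j / complex_of_real (u i * v j)) * complex_of_real (v j)))"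
        by (simp add: w_def V_def B_def schur_product_def matrix_vector_mult_def sum_distrib_left)
      also have "\<dots> = (\<Sum>j\<in>UNIV. A i j * X $ i $ j)"
        using u(1)[of i] v(1) by (intro sum.cong refl) (simp add: less_imp_neq[THEN not_sym])
      finally show ?thesis by simp
    qed
    then have "2 * ?P = (\<Sum>i\<in>UNIV. 2 * (u i * Re (w $ i)))"
      by (simp add: sum_distrib_left)
    also have "\<dots> \<le> (\<Sum>i\<in>UNIV. (u i)\<^sup>2 + (cmod (w $ i))\<^sup>2)"
    proof (rule sum_mono)
      fix i
      have "2 * (u i * Re (w $ i)) \<le> 2 * (u i * cmod (w $ i))"
        using u(1)[of i] complex_Re_le_cmod by (intro mult_left_mono) auto
      also have "\<dots> \<le> (u i)\<^sup>2 + (cmod (w $ i))\<^sup>2"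
        using zero_le_power2[of "u i - cmod (w $ i)"] by (simp add: power2_diff)
      finally show "2 * (u i * Re (w $ i)) \<le> (u i)\<^sup>2 + (cmod (w $ i))\<^sup>2" .
    qed
    also have "\<dots> = (\<Sum>i\<in>UNIV. (u i)\<^sup>2) + (norm w)\<^sup>2" by (simp add: sum.distrib norm_vec_sq)
    also have "\<dots> \<le> (\<Sum>i\<in>UNIV. (u i)\<^sup>2) + (norm V)\<^sup>2" using wV by simp
    also have "(norm V)\<^sup>2 = (\<Sum>j\<in>UNIV. (v j)\<^sup>2)" by (simp add: norm_vec_sq V_def)
    also have "(\<Sum>i\<in>UNIV. (u i)\<^sup>2) + (\<Sum>j\<in>UNIV. (v j)\<^sup>2) = M + e * (CARD('m) + CARD('n))"
      unfolding u(2) v(2) by (simp add: sum.distrib M[symmetric] algebra_simps)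
    finally show ?thesis .
  qed
  show ?thesis
  proof (rule field_le_epsilon)
    fix d :: real assume d: "0 < d"
    define c where "c = real CARD('m) + real CARD('n)"
    have "0 < c" unfolding c_def by (simp add: add_pos_pos)
    then show "2 * ?P \<le> M + d" using approx[of "d / c"] d by (simp add: c_def[symmetric])
  qed
qed

lemma exists_unimodular_ge:
  fixes c :: "'a::finite \<Rightarrow> complex"
  assumes "\<And>j. cmod (v j) \<le> 1"
  shows "\<exists>v'. (\<forall>j. cmod (v' j) = 1) \<and> Re (\<Sum>j\<in>UNIV. c j * v j) \<le> Re (\<Sum>j\<in>UNIV. c j * v' j)"
proof -
  define v' where "v' = (\<lambda>j. if c j = 0 then 1 else cnj (sgn (c j)))"
  have "Re (c j * v j) \<le> Re (c j * v' j)" for j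
  proof -
    have "Re (c j * v j) \<le> cmod (c j) * cmod (v j)"
      using complex_Re_le_cmod[of "c j * v j"] by (simp add: norm_mult)
    also have "\<dots> \<le> cmod (c j)" using assms by (intro mult_left_le) auto
    also have "c j * v' j = complex_of_real (cmod (c j))"
      by (simp add: v'_def sgn_eq complex_norm_square[symmetric] power2_eq_square)
    then have "cmod (c j) = Re (c j * v' j)" by simp
    finally show ?thesis .
  qed
  then have "Re (\<Sum>j\<in>UNIV. c j * v j) \<le> Re (\<Sum>j\<in>UNIV. c j * v' j)"
    by (simp add: sum_mono)
  moreover have "cmod (v' j) = 1" for j by (simp add: v'_def norm_sgn)
  ultimately show ?thesis by blast
qed

text \<open>A bilinear form is maximised over the polydisc at unimodular vectors: with one argument
  fixed it is linear in the other, whose phases can be aligned.\<close>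

lemma disc_le_unimodular:
  fixes A :: "'m::finite \<Rightarrow> 'n::finite \<Rightarrow> complex"
  assumes N: "\<And>u v. (\<And>i. cmod (u i) = 1) \<Longrightarrow> (\<And>j. cmod (v j) = 1) \<Longrightarrow>
      Re (\<Sum>i\<in>UNIV. \<Sum>j\<in>UNIV. A i j * u i * v j) \<le> N"
    and u: "\<And>i. cmod (u i) \<le> 1" and v: "\<And>j. cmod (v j) \<le> 1"
  shows "Re (\<Sum>i\<in>UNIV. \<Sum>j\<in>UNIV. A i j * u i * v j) \<le> N"
proof -
  have 1: "(\<Sum>i\<in>UNIV. \<Sum>j\<in>UNIV. A i j * u i * v j) = (\<Sum>j\<in>UNIV. (\<Sum>i\<in>UNIV. A i j * u i) * v j)" for u v
    by (subst sum.swap) (simp add: sum_distrib_right)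
  have 2: "(\<Sum>i\<in>UNIV. \<Sum>j\<in>UNIV. A i j * u i * v j) = (\<Sum>i\<in>UNIV. (\<Sum>j\<in>UNIV. A i j * v j) * u i)" for u v
    by (simp add: sum_distrib_left sum_distrib_right mult_ac)
  obtain v' where v': "\<And>j. cmod (v' j) = 1"
    "Re (\<Sum>i\<in>UNIV. \<Sum>j\<in>UNIV. A i j * u i * v j) \<le> Re (\<Sum>i\<in>UNIV. \<Sum>j\<in>UNIV. A i j * u i * v' j)"
    using exists_unimodular_ge[where v = v, OF v, of "\<lambda>j. \<Sum>i\<in>UNIV. A i j * u i"] unfolding 1[symmetric] by blast
  obtain u' where u': "\<And>i. cmod (u' i) = 1"
    "Re (\<Sum>i\<in>UNIV. \<Sum>j\<in>UNIV. A i j * u i * v' j) \<le> Re (\<Sum>i\<in>UNIV. \<Sum>j\<in>UNIV. A i j * u' i * v' j)"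
    using exists_unimodular_ge[where v = u, OF u, of "\<lambda>i. \<Sum>j\<in>UNIV. A i j * v' j"] unfolding 2[symmetric] by blast
  show ?thesis using v'(2) u'(2) N[of u' v', OF u'(1) v'(1)] by linarith
qed

lemma sum_UNIV_sum:
  "(\<Sum>x\<in>UNIV. f x) = (\<Sum>i\<in>UNIV. f (Inl i)) + (\<Sum>j\<in>UNIV. f (Inr j))"
  for f :: "'m::finite + 'n::finite \<Rightarrow> 'b::comm_monoid_add"
  by (simp add: UNIV_Plus_UNIV[symmetric] sum.Plus del: UNIV_Plus_UNIV)

text \<open>The heart of the argument. Positive semidefiniteness of \<open>F\<close>, the sum of the diagonal form of mass
  \<open>M\<close> and twice the real part of the form of \<open>A\<close>, gives \<open>F a = |Y a|\<^sup>2\<close> for some matrix \<open>Y\<close>. On vectors with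
  entries in the unit disc \<open>F\<close> is at most \<open>M + 2 N\<close>, so the little Grothendieck inequality puts \<open>F\<close>
  below a diagonal form of mass \<open>Q\<close>. Subtracting the old diagonal leaves a domination of \<open>A\<close>
  alone, of mass \<open>Q - M\<close>.\<close>

lemma form_dominated_improve:
  fixes A :: "'m::finite \<Rightarrow> 'n::finite \<Rightarrow> complex"
  assumes dM: "form_dominated A M"
    and N: "\<And>u v. (\<And>i. cmod (u i) = 1) \<Longrightarrow> (\<And>j. cmod (v j) = 1) \<Longrightarrow>
      Re (\<Sum>i\<in>UNIV. \<Sum>j\<in>UNIV. A i j * u i * v j) \<le> N"
    and Q: "little_grothendieck_complex * (M + 2 * N) < Q"
  shows "form_dominated A (Q - M)"
proof -
  obtain l t where l: "\<And>i. 0 \<le> l i" and t: "\<And>j. 0 \<le> t j" and M: "sum l UNIV + sum t UNIV = M"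
    and dom: "\<And>p q. 2 * Re (\<Sum>i\<in>UNIV. \<Sum>j\<in>UNIV. A i j * p i * q j) \<le>
       (\<Sum>i\<in>UNIV. l i * (cmod (p i))\<^sup>2) + (\<Sum>j\<in>UNIV. t j * (cmod (q j))\<^sup>2)"
    using dM unfolding form_dominated_def by blast
  define H where "H = (\<lambda>x y. case x of
      Inl i \<Rightarrow> (case y of Inl i' \<Rightarrow> if i = i' then complex_of_real (l i) else 0 | Inr j \<Rightarrow> A i j)
    | Inr j \<Rightarrow> (case y of Inl i \<Rightarrow> cnj (A i j) | Inr j' \<Rightarrow> if j = j' then complex_of_real (t j) else 0))"
  define F where "F = (\<lambda>a. (\<Sum>i\<in>UNIV. l i * (cmod (a (Inl i)))\<^sup>2) + (\<Sum>j\<in>UNIV. t j * (cmod (a (Inr j)))\<^sup>2) +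
    2 * Re (\<Sum>i\<in>UNIV. \<Sum>j\<in>UNIV. A i j * cnj (a (Inl i)) * a (Inr j)))"
  have diag: "Re (cnj z * complex_of_real r * z) = r * (cmod z)\<^sup>2" for z r
    unfolding cmod_power2 by (simp add: power2_eq_square algebra_simps)
  have F: "Re (\<Sum>x\<in>UNIV. \<Sum>y\<in>UNIV. cnj (a x) * H x y * a y) = F a" for a
  proof -
    have 11: "(\<Sum>i'\<in>UNIV. cnj (a (Inl i)) * H (Inl i) (Inl i') * a (Inl i')) =
        cnj (a (Inl i)) * complex_of_real (l i) * a (Inl i)" for i
      by (simp add: H_def if_distrib[of "\<lambda>x. _ * x"] if_distrib[of "\<lambda>x. x * _"] cong: if_cong)
    have 22: "(\<Sum>j'\<in>UNIV. cnj (a (Inr j)) * H (Inr j) (Inr j') * a (Inr j')) =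
        cnj (a (Inr j)) * complex_of_real (t j) * a (Inr j)" for j
      by (simp add: H_def if_distrib[of "\<lambda>x. _ * x"] if_distrib[of "\<lambda>x. x * _"] cong: if_cong)
    let ?S = "\<Sum>i\<in>UNIV. \<Sum>j\<in>UNIV. A i j * cnj (a (Inl i)) * a (Inr j)"
    have 12: "(\<Sum>i\<in>UNIV. \<Sum>j\<in>UNIV. cnj (a (Inl i)) * H (Inl i) (Inr j) * a (Inr j)) = ?S"
      by (simp add: H_def mult_ac)
    have 21: "(\<Sum>j\<in>UNIV. \<Sum>i\<in>UNIV. cnj (a (Inr j)) * H (Inr j) (Inl i) * a (Inl i)) = cnj ?S"
      by (subst sum.swap) (simp add: H_def mult_ac)
    have "(\<Sum>x\<in>UNIV. \<Sum>y\<in>UNIV. cnj (a x) * H x y * a y) =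
        (\<Sum>i\<in>UNIV. cnj (a (Inl i)) * complex_of_real (l i) * a (Inl i)) + ?S +
        (cnj ?S + (\<Sum>j\<in>UNIV. cnj (a (Inr j)) * complex_of_real (t j) * a (Inr j)))"
      unfolding sum_UNIV_sum sum.distrib 11 22 12 21 by (simp only: add_ac)
    moreover have "Re (cnj z) = Re z" for z by simp
    ultimately have "Re (\<Sum>x\<in>UNIV. \<Sum>y\<in>UNIV. cnj (a x) * H x y * a y) =
        (\<Sum>i\<in>UNIV. l i * (cmod (a (Inl i)))\<^sup>2) + Re ?S + (Re ?S + (\<Sum>j\<in>UNIV. t j * (cmod (a (Inr j)))\<^sup>2))"
      by (simp only: plus_complex.sel Re_sum[of "\<lambda>i. cnj (a (Inl i)) * complex_of_real (l i) * a (Inl i)"]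
          Re_sum[of "\<lambda>j. cnj (a (Inr j)) * complex_of_real (t j) * a (Inr j)"] diag)
    then show ?thesis unfolding F_def by linarith
  qed
  have "\<exists>Y :: 'm + 'n \<Rightarrow> 'm + 'n \<Rightarrow> complex. \<forall>a. F a = (\<Sum>k\<in>UNIV. (cmod (\<Sum>j\<in>UNIV. Y k j * a j))\<^sup>2)"
    unfolding F[symmetric]
  proof (rule psd_imp_gram)
    show "H y x = cnj (H x y)" for x y by (auto simp: H_def split: sum.splits)
    show "0 \<le> Re (\<Sum>x\<in>UNIV. \<Sum>y\<in>UNIV. cnj (a x) * H x y * a y)" for a
      unfolding F F_def
      \<comment> \<open>Domination is applied with the sign of the first argument reversed.\<close>
      using dom[of "\<lambda>i. - cnj (a (Inl i))" "\<lambda>j. a (Inr j)"] by (simp add: sum_negf)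
  qed simp
  then obtain Y :: "'m + 'n \<Rightarrow> 'm + 'n \<Rightarrow> complex" where Y: "\<And>a. F a = (\<Sum>k\<in>UNIV. (cmod (\<Sum>j\<in>UNIV. Y k j * a j))\<^sup>2)" by blast
  have "F x \<le> M + 2 * N" if x: "\<And>j. cmod (x j) \<le> 1" for x
  proof -
    have "(\<Sum>i\<in>UNIV. l i * (cmod (x (Inl i)))\<^sup>2) \<le> sum l UNIV"
      using x l by (intro sum_mono mult_left_le) (auto simp: power_le_one)
    moreover have "(\<Sum>j\<in>UNIV. t j * (cmod (x (Inr j)))\<^sup>2) \<le> sum t UNIV"
      using x t by (intro sum_mono mult_left_le) (auto simp: power_le_one)
    moreover have "Re (\<Sum>i\<in>UNIV. \<Sum>j\<in>UNIV. A i j * cnj (x (Inl i)) * x (Inr j)) \<le> N"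
      using x by (intro disc_le_unimodular[OF N]) auto
    ultimately show ?thesis unfolding F_def M[symmetric] by linarith
  qed
  then have "\<And>x. (\<And>j. cmod (x j) \<le> 1) \<Longrightarrow> (\<Sum>k\<in>UNIV. (cmod (\<Sum>j\<in>UNIV. Y k j * x j))\<^sup>2) \<le> M + 2 * N"
    unfolding Y .
  from little_grothendieck_finite_type[OF this Q]
  obtain \<mu> where \<mu>: "sum \<mu> UNIV = Q" "\<And>a. F a \<le> (\<Sum>x\<in>UNIV. \<mu> x * (cmod (a x))\<^sup>2)"
    unfolding Y by blast
  have delta: "(\<Sum>x\<in>UNIV. \<mu> x * (cmod (if x = z then 1 else 0))\<^sup>2) = \<mu> z" for z
    by (simp add: if_distrib[of cmod] if_distrib[of "\<lambda>x. x\<^sup>2"] if_distrib[of "\<lambda>x. _ * x"] cong: if_cong)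
  \<comment> \<open>At a unit coordinate vector the off-diagonal part of \<open>F\<close> vanishes.\<close>
  have li: "l i \<le> \<mu> (Inl i)" for i
    using \<mu>(2)[of "\<lambda>x. if x = Inl i then 1 else 0"] unfolding delta
    by (simp add: F_def if_distrib[of cmod] if_distrib[of "\<lambda>x. x\<^sup>2"] if_distrib[of "\<lambda>x. _ * x"] cong: if_cong)
  have tj: "t j \<le> \<mu> (Inr j)" for j
    using \<mu>(2)[of "\<lambda>x. if x = Inr j then 1 else 0"] unfolding delta
    by (simp add: F_def if_distrib[of cmod] if_distrib[of "\<lambda>x. x\<^sup>2"] if_distrib[of "\<lambda>x. _ * x"] cong: if_cong)
  show ?thesis unfolding form_dominated_def
  proof (intro exI[of _ "\<lambda>i. \<mu> (Inl i) - l i"] exI[of _ "\<lambda>j. \<mu> (Inr j) - t j"] conjI allI)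
    show "0 \<le> \<mu> (Inl i) - l i" "0 \<le> \<mu> (Inr j) - t j" for i j using li tj by simp_all
    show "(\<Sum>i\<in>UNIV. \<mu> (Inl i) - l i) + (\<Sum>j\<in>UNIV. \<mu> (Inr j) - t j) = Q - M"
      using \<mu>(1) M unfolding sum_UNIV_sum sum_subtractf by linarith
    show "2 * Re (\<Sum>i\<in>UNIV. \<Sum>j\<in>UNIV. A i j * p i * q j) \<le>
       (\<Sum>i\<in>UNIV. (\<mu> (Inl i) - l i) * (cmod (p i))\<^sup>2) + (\<Sum>j\<in>UNIV. (\<mu> (Inr j) - t j) * (cmod (q j))\<^sup>2)" for p q
      using \<mu>(2)[of "case_sum (\<lambda>i. cnj (p i)) q"]
      unfolding F_def sum_UNIV_sum by (simp add: left_diff_distrib sum_subtractf)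
  qed
qed

lemma form_dominated_exists: "\<exists>M. form_dominated A M"
proof -
  let ?l = "\<lambda>i. \<Sum>j\<in>UNIV. cmod (A i j)" and ?t = "\<lambda>j. \<Sum>i\<in>UNIV. cmod (A i j)"
  have "2 * Re (\<Sum>i\<in>UNIV. \<Sum>j\<in>UNIV. A i j * p i * q j) \<le>
       (\<Sum>i\<in>UNIV. ?l i * (cmod (p i))\<^sup>2) + (\<Sum>j\<in>UNIV. ?t j * (cmod (q j))\<^sup>2)" for p q
  proof -
    have "2 * Re (\<Sum>i\<in>UNIV. \<Sum>j\<in>UNIV. A i j * p i * q j) = (\<Sum>i\<in>UNIV. \<Sum>j\<in>UNIV. 2 * Re (A i j * p i * q j))"
      by (simp only: Re_sum sum_distrib_left)
    also have "\<dots> \<le> (\<Sum>i\<in>UNIV. \<Sum>j\<in>UNIV. cmod (A i j) * (cmod (p i))\<^sup>2 + cmod (A i j) * (cmod (q j))\<^sup>2)"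
    proof (intro sum_mono)
      fix i j
      have "2 * Re (A i j * p i * q j) \<le> 2 * cmod (A i j * p i * q j)"
        by (intro mult_left_mono complex_Re_le_cmod) simp
      also have "\<dots> = cmod (A i j) * (2 * cmod (p i) * cmod (q j))" by (simp add: norm_mult)
      also have "\<dots> \<le> cmod (A i j) * ((cmod (p i))\<^sup>2 + (cmod (q j))\<^sup>2)"
        by (intro mult_left_mono sum_squares_bound) auto
      finally show "2 * Re (A i j * p i * q j) \<le> cmod (A i j) * (cmod (p i))\<^sup>2 + cmod (A i j) * (cmod (q j))\<^sup>2"
        by (simp add: distrib_left)
    qed
    also have "\<dots> = (\<Sum>i\<in>UNIV. ?l i * (cmod (p i))\<^sup>2) + (\<Sum>j\<in>UNIV. ?t j * (cmod (q j))\<^sup>2)"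
      unfolding sum.distrib sum_distrib_right by (subst (2) sum.swap) simp
    finally show ?thesis .
  qed
  then have "form_dominated A (sum ?l UNIV + sum ?t UNIV)"
    unfolding form_dominated_def by (intro exI[of _ ?l] exI[of _ ?t]) (auto intro!: sum_nonneg)
  then show ?thesis by blast
qed

text \<open>Grothendieck's inequality in dual form. Let \<open>k\<close> be the little Grothendieck constant. The infimum
  \<open>M\<close> of all dominating masses satisfies \<open>M \<le> k (M + 2 N) - M\<close>, hence \<open>M \<le> 2 k N / (2 - k)\<close>, where
  \<open>k < 2\<close> is needed for the division.\<close>

lemma schur_norm_pairing_le:
  fixes X :: "complex^'n^'m"
  assumes X: "schur_norm X \<le> 1"
    and N: "\<And>u v. (\<And>i. cmod (u i) = 1) \<Longrightarrow> (\<And>j. cmod (v j) = 1) \<Longrightarrow>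
      Re (\<Sum>i\<in>UNIV. \<Sum>j\<in>UNIV. A i j * u i * v j) \<le> N"
  shows "Re (\<Sum>i\<in>UNIV. \<Sum>j\<in>UNIV. A i j * X $ i $ j)
    \<le> little_grothendieck_complex / (2 - little_grothendieck_complex) * N"
proof -
  let ?k = little_grothendieck_complex and ?S = "{M. form_dominated A M}"
  have k: "1 \<le> ?k" "?k < 2" using little_grothendieck_ge_1 little_grothendieck_le by auto
  have ne: "?S \<noteq> {}" using form_dominated_exists[of A] by simp
  have bdd: "bdd_below ?S"
    by (rule bdd_belowI[of _ 0]) (auto simp: form_dominated_def intro!: add_nonneg_nonneg sum_nonneg)
  have "Inf ?S \<le> (2 * ?k * N) / (1 - (?k - 1))"
  proof (rule Inf_self_improving[OF ne])
    show "Inf ?S \<le> 2 * ?k * N + (?k - 1) * M" if "M \<in> ?S" for M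
    proof (rule field_le_epsilon)
      fix e :: real assume "0 < e"
      let ?Q = "?k * (M + 2 * N) + e"
      have "form_dominated A (?Q - M)"
      proof (rule form_dominated_improve)
        show "form_dominated A M" using that by simp
        show "Re (\<Sum>i\<in>UNIV. \<Sum>j\<in>UNIV. A i j * u i * v j) \<le> N"
          if "\<And>i. cmod (u i) = 1" "\<And>j. cmod (v j) = 1" for u v
          using N that by blast
      qed (use \<open>0 < e\<close> in simp)
      then have "Inf ?S \<le> ?Q - M" using bdd by (intro cInf_lower) auto
      then show "Inf ?S \<le> 2 * ?k * N + (?k - 1) * M + e" by (simp add: algebra_simps)
    qed
  qed (use k in auto)
  also have "\<dots> = 2 * (?k / (2 - ?k) * N)" by simp
  finally have "Inf ?S \<le> 2 * (?k / (2 - ?k) * N)" .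
  moreover have "2 * Re (\<Sum>i\<in>UNIV. \<Sum>j\<in>UNIV. A i j * X $ i $ j) \<le> Inf ?S"
    by (rule cInf_greatest[OF ne]) (blast intro: form_dominated_imp_pairing_le[OF X])
  ultimately show ?thesis by linarith
qed

section \<open>Membership in the scaled unimodular hull\<close>

theorem theorem5p6:
  fixes X :: "complex^'n^'m"
  assumes "schur_norm X = 1"
  shows "X \<in> (\<lambda>V. (little_grothendieck_complex / (2 - little_grothendieck_complex)) *\<^sub>R V) ` unimodular_hull"
proof (rule ccontr)
  define \<kappa> where "\<kappa> = little_grothendieck_complex / (2 - little_grothendieck_complex)"
  have \<kappa>: "0 < \<kappa>" unfolding \<kappa>_def
    using little_grothendieck_ge_1 little_grothendieck_le by (intro divide_pos_pos) auto
  let ?S = "(\<lambda>V. \<kappa> *\<^sub>R V) ` (unimodular_hull :: (complex^'n^'m) set)"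
  assume "\<not> ?thesis"
  then have "X \<notin> ?S" by (simp add: \<kappa>_def)
  moreover have "convex ?S" "closed ?S"
    unfolding unimodular_hull_def
    by (intro convex_scaling convex_closure convex_convex_hull closed_scaling closed_closure)+
  ultimately obtain a b where ab: "inner a X < b" "\<And>Z. Z \<in> ?S \<Longrightarrow> b < inner a Z"
    using separating_hyperplane_closed_point[of ?S X] by blast
  define A where "A = (\<lambda>i j. - cnj (a $ i $ j))"
  have A: "Re (\<Sum>i\<in>UNIV. \<Sum>j\<in>UNIV. A i j * Z $ i $ j) = - inner a Z" for Z :: "complex^'n^'m"
    by (simp add: A_def inner_vec_def inner_complex_def sum_negf)
  have "Re (\<Sum>i\<in>UNIV. \<Sum>j\<in>UNIV. A i j * X $ i $ j) \<le> \<kappa> * (- b / \<kappa>)"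
    unfolding \<kappa>_def
  proof (rule schur_norm_pairing_le, fold \<kappa>_def)
    fix u :: "'m \<Rightarrow> complex" and v :: "'n \<Rightarrow> complex"
    assume u: "\<And>i. cmod (u i) = 1" and v: "\<And>j. cmod (v j) = 1"
    define Z :: "complex^'n^'m" where "Z = (\<chi> i j. u i * v j)"
    have "Z = (\<chi> i j. (\<chi> i. u i) $ i * (\<chi> j. v j) $ j)" by (simp add: Z_def)
    then have "Z \<in> {(\<chi> i j. u $ i * v $ j) | u v. (\<forall>i. cmod (u $ i) = 1) \<and> (\<forall>j. cmod (v $ j) = 1)}"
      using u v by (intro CollectI exI[of _ "\<chi> i. u i"] exI[of _ "\<chi> j. v j"]) simp
    then have "Z \<in> unimodular_hull"
      unfolding unimodular_hull_def by (meson closure_subset hull_subset subsetD)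
    then have "b < \<kappa> * inner a Z" using ab(2)[OF imageI] by fastforce
    then have "- inner a Z \<le> - b / \<kappa>" using \<kappa> by (simp add: field_simps)
    then show "Re (\<Sum>i\<in>UNIV. \<Sum>j\<in>UNIV. A i j * u i * v j) \<le> - b / \<kappa>"
      using A[of Z] by (simp add: Z_def mult.assoc)
  qed (use assms in simp)
  then show False using ab(1) \<kappa> unfolding A by simp
qed

end
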